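(* Fix $\lambda\in\mathbb{R}$ and let $\mathcal{C}_1$ be the largest component of $D(n,p)$ for $p=n^{-1}+\lambda n^{-4/3}$. Then $|\mathcal{C}_1|=\Theta_p(n^{1/3})$ as $n\to\infty$.
   Context: $D(n,p)$ is the random digraph on vertex set $[n]=\{1,\dots,n\}$ in which each of the $n(n-1)$ possible directed edges (ordered pairs of distinct vertices) is included with probability $p$ independently of all others. "Component" means strongly connected component; $|\mathcal{C}_1|$ is the number of vertices of a largest strongly connected component. For a sequence of nonnegative random variables $Z_n$, $Z_n=\Theta_p(n^{1/3})$ means: for every $\varepsilon>0$ there are constants $0<c<C<\infty$ and $n_0$ such that $\mathbb{P}(c\,n^{1/3}\le Z_n\le C\,n^{1/3})\ge 1-\varepsilon$ for all $n\ge n_0$. *)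

theory Defs
  imports "HOL-Probability.Probability" "Graph_Theory.Graph_Theory"
begin

text \<open>
  The default value \<open>False\<close> of the product excludes every pair outside the index set, in
  particular the loops.  The edge probability \<open>p\<close> is meant to lie in \<open>[0,1]\<close>;
  \<^const>\<open>bernoulli_pmf\<close> truncates other values to this interval.
\<close>

definition random_digraph :: "nat \<Rightarrow> real \<Rightarrow> nat pair_pre_digraph pmf" where
  "random_digraph n p =
     map_pmf (\<lambda>b. \<lparr>pverts = {1..n}, parcs = {e. b e}\<rparr>)
       (Pi_pmf {(u, v). u \<in> {1..n} \<and> v \<in> {1..n} \<and> u \<noteq> v} False (\<lambda>_. bernoulli_pmf p))"

text \<open>
  Several components may have maximal size; their common number of vertices does not depend on
  the choice.  The maximum is meaningful for finite digraphs with at least one vertex.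
\<close>

definition largest_scc_size :: "'a pair_pre_digraph \<Rightarrow> nat" where
  "largest_scc_size G = Max ((\<lambda>H. card (verts H)) ` pre_digraph.sccs (with_proj G))"

lemma pair_digraph_random_digraph:
  assumes "G \<in> set_pmf (random_digraph n p)"
  shows "pair_digraph G" "pverts G = {1..n}"
proof -
  let ?A = "{(u, v). u \<in> {1..n} \<and> v \<in> {1..n} \<and> u \<noteq> v}"
  have fin: "finite ?A"
    by (rule finite_subset[of _ "{1..n} \<times> {1..n}"]) auto
  obtain b where b: "b \<in> set_pmf (Pi_pmf ?A False (\<lambda>_. bernoulli_pmf p))"
    and G: "G = \<lparr>pverts = {1..n}, parcs = {e. b e}\<rparr>"
    using assms by (auto simp: random_digraph_def)
  have sub: "{e. b e} \<subseteq> ?A"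
    using b set_Pi_pmf_subset[OF fin, of False "\<lambda>_. bernoulli_pmf p"] by blast
  show "pair_digraph G"
  proof
    show "finite (pverts G)" "finite (parcs G)"
      using G finite_subset[OF sub fin] by auto
  qed (use sub G in auto)
  show "pverts G = {1..n}"
    by (simp add: G)
qed

lemma largest_scc_size_wellformed:
  assumes "pair_digraph G" "pverts G \<noteq> {}"
  defines "S \<equiv> pre_digraph.sccs (with_proj G)"
  shows "finite S" "S \<noteq> {}"
proof -
  interpret pair_digraph G by fact
  have S: "S = induce_subgraph (with_proj G) ` pre_digraph.sccs_verts (with_proj G)"
    unfolding S_def by (rule sccs_conv_sccs_verts)
  show "finite S"
    unfolding S by (intro finite_imageI finite_sccs_verts)
  show "S \<noteq> {}"
    using assms(2) unfolding S by (auto simp: sccs_verts_conv_scc_of)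
qed

definition Theta_p ::
    "(nat \<Rightarrow> 'a measure) \<Rightarrow> (nat \<Rightarrow> 'a \<Rightarrow> real) \<Rightarrow> (nat \<Rightarrow> real) \<Rightarrow> bool" where
  "Theta_p M Z f \<longleftrightarrow>
     (\<forall>\<epsilon>>0. \<exists>c C n0. 0 < c \<and> c < C \<and>
        (\<forall>n\<ge>n0. \<P>(\<omega> in M n. c * f n \<le> Z n \<omega> \<and> Z n \<omega> \<le> C * f n) \<ge> 1 - \<epsilon>))"

end

theory Submission
  imports Defs
begin

text \<open>
  Write \<open>t\<close> for the cube root of \<open>n\<close>.

  Upper bound.  Every vertex of a nontrivial strong component lies on a closed walk, so by Markov's
  inequality it suffices that a vertex \<open>v\<close> lies on a closed walk with probability \<open>O(1 / t\<^sup>2)\<close>.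
  The expected number of cycles of length at most \<open>2 t\<close> through \<open>v\<close> is \<open>O(t / n)\<close>.  If there is a
  closed walk but no such cycle, then \<open>v\<close> starts a path of length \<open>t\<close> with tails in a ball around
  \<open>v\<close> and ends a path of length \<open>t\<close> with tails outside that ball.  Given the ball these events are
  independent, and as for critical branching processes each has probability \<open>O(1 / t)\<close>.

  Lower bound.  The expected number of cycles with length between \<open>\<delta> t\<close> and \<open>\<eta> t\<close> is of order
  \<open>ln (\<eta> / \<delta>)\<close>, and for small \<open>\<eta>\<close> the pairs of intersecting cycles contribute only a constant
  multiple of the mean to its variance.  By Chebyshev's inequality such a cycle exists with
  probability close to 1 once \<open>\<delta>\<close> is small.
\<close>

section \<open>Independent arcs\<close>

text \<open>The product measure splits into independent factors over \<open>A \<inter> I\<close> and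
  \<open>A - I\<close>, and each predicate reads only one of them.\<close>

lemma prob_Pi_pmf_indep:
  assumes fin: "finite A"
    and P: "\<And>f g. (\<And>x. x \<in> I \<Longrightarrow> f x = g x) \<Longrightarrow> P f \<longleftrightarrow> P g"
    and Q: "\<And>f g. (\<And>x. x \<notin> I \<Longrightarrow> f x = g x) \<Longrightarrow> Q f \<longleftrightarrow> Q g"
  shows "measure_pmf.prob (Pi_pmf A d p) {f. P f \<and> Q f} =
         measure_pmf.prob (Pi_pmf A d p) {f. P f} * measure_pmf.prob (Pi_pmf A d p) {f. Q f}"
proof -
  let ?M = "Pi_pmf (A \<inter> I) d p" and ?N = "Pi_pmf (A - I) d p"
  have split: "Pi_pmf A d p =
      map_pmf (\<lambda>(f, g) x. if x \<in> A \<inter> I then f x else g x) (pair_pmf ?M ?N)"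
    using Pi_pmf_union[of "A \<inter> I" "A - I" d p] fin
    by (simp add: Int_Diff_Un) (simp add: Int_Diff_disjoint)
  have key: "measure_pmf.prob (Pi_pmf A d p) {f. R f \<and> S f} =
      measure_pmf.prob ?M {f. R f} * measure_pmf.prob ?N {f. S f}"
    if R: "\<And>f g. (\<And>x. x \<in> I \<Longrightarrow> f x = g x) \<Longrightarrow> R f \<longleftrightarrow> R g"
      and S: "\<And>f g. (\<And>x. x \<notin> I \<Longrightarrow> f x = g x) \<Longrightarrow> S f \<longleftrightarrow> S g" for R S
  proof -
    let ?m = "\<lambda>(f, g) x. if x \<in> A \<inter> I then f x else g x"
    have "measure_pmf.prob (Pi_pmf A d p) {f. R f \<and> S f} =
        measure_pmf.prob (pair_pmf ?M ?N) (?m -` {f. R f \<and> S f})"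
      unfolding split by simp
    \<comment> \<open>The two sets agree only on the support: at points of \<open>I - A\<close> the
      merged function takes its value from \<open>g\<close>, which equals the default
      \<open>d\<close> there, just as \<open>f\<close> does.\<close>
    also have "\<dots> = measure_pmf.prob (pair_pmf ?M ?N) ({f. R f} \<times> {f. S f})"
    proof (rule measure_pmf.finite_measure_eq_AE)
      have "z \<in> ?m -` {f. R f \<and> S f} \<longleftrightarrow> z \<in> {f. R f} \<times> {f. S f}"
        if z: "z \<in> set_pmf (pair_pmf ?M ?N)" for z
      proof -
        obtain f g where fg: "z = (f, g)" "f \<in> set_pmf ?M" "g \<in> set_pmf ?N"
          using z by auto
        have f: "f x = d" if "x \<notin> A \<inter> I" for x
          using set_Pi_pmf_subset[of "A \<inter> I" d p] fin fg(2) that by blast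
        have g: "g x = d" if "x \<notin> A - I" for x
          using set_Pi_pmf_subset[of "A - I" d p] fin fg(3) that by blast
        have "R (?m z) \<longleftrightarrow> R f"
          by (rule R) (auto simp: fg(1) f g)
        moreover have "S (?m z) \<longleftrightarrow> S g"
          by (rule S) (auto simp: fg(1) f g)
        ultimately show ?thesis
          by (simp add: fg(1))
      qed
      then show "AE z in measure_pmf (pair_pmf ?M ?N).
          (z \<in> ?m -` {f. R f \<and> S f}) = (z \<in> {f. R f} \<times> {f. S f})"
        by (simp add: AE_measure_pmf_iff)
    qed simp_all
    also have "\<dots> = measure_pmf.prob ?M {f. R f} * measure_pmf.prob ?N {f. S f}"
    proof -
      have "measure_pmf.prob (pair_pmf ?M ?N) ({f. R f} \<times> {f. S f}) =
        measure_pmf.prob (pair_pmf ?M ?N) (({f. R f} \<inter> set_pmf ?M) \<times> ({f. S f} \<inter> set_pmf ?N))"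
        by (rule measure_prob_cong_0) (auto simp: pmf_pair set_pmf_iff)
      also have "\<dots> = measure_pmf.prob ?M ({f. R f} \<inter> set_pmf ?M) *
          measure_pmf.prob ?N ({f. S f} \<inter> set_pmf ?N)"
        by (rule measure_pmf_prob_product) auto
      finally show ?thesis
        by (simp add: measure_Int_set_pmf)
    qed
    finally show ?thesis .
  qed
  show ?thesis
  proof -
    \<comment> \<open>The instances with \<open>True\<close> identify the factors over
      \<open>?M\<close> and \<open>?N\<close> with probabilities under the whole product.\<close>
    have "measure_pmf.prob (Pi_pmf A d p) {f. P f \<and> Q f} =
        measure_pmf.prob ?M {f. P f} * measure_pmf.prob ?N {f. Q f}"
      by (rule key) (fact P, fact Q)
    moreover have "measure_pmf.prob (Pi_pmf A d p) {f. P f \<and> True} =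
        measure_pmf.prob ?M {f. P f} * measure_pmf.prob ?N {f. True}"
      by (rule key) (fact P, rule refl)
    moreover have "measure_pmf.prob (Pi_pmf A d p) {f. True \<and> Q f} =
        measure_pmf.prob ?M {f. True} * measure_pmf.prob ?N {f. Q f}"
      by (rule key) (rule refl, fact Q)
    ultimately show ?thesis
      by simp
  qed
qed

section \<open>Arc indicators of the random digraph\<close>

definition arc_slots :: "nat \<Rightarrow> (nat \<times> nat) set" where
  "arc_slots n = {(u, v). u \<in> {1..n} \<and> v \<in> {1..n} \<and> u \<noteq> v}"

definition arcs_pmf :: "nat \<Rightarrow> real \<Rightarrow> (nat \<times> nat \<Rightarrow> bool) pmf" where
  "arcs_pmf n p = Pi_pmf (arc_slots n) False (\<lambda>_. bernoulli_pmf p)"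

abbreviation arcs_prob :: "nat \<Rightarrow> real \<Rightarrow> ((nat \<times> nat \<Rightarrow> bool) \<Rightarrow> bool) \<Rightarrow> real" where
  "arcs_prob n p P \<equiv> measure_pmf.prob (arcs_pmf n p) {b. P b}"

lemma finite_arc_slots [simp]: "finite (arc_slots n)"
  by (rule finite_subset[of _ "{1..n} \<times> {1..n}"]) (auto simp: arc_slots_def)

lemma arcs_pmf_subset_slots: "b \<in> set_pmf (arcs_pmf n p) \<Longrightarrow> Collect b \<subseteq> arc_slots n"
  using set_Pi_pmf_subset[of "arc_slots n" False "\<lambda>_. bernoulli_pmf p"]
  by (auto simp: arcs_pmf_def)

text \<open>Finite support makes every real function integrable and leaves only finitely many
  possible balls in \<open>closed_walk_prob\<close>.\<close>

lemma finite_set_arcs_pmf [simp]: "finite (set_pmf (arcs_pmf n p))"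
proof (rule finite_subset)
  show "set_pmf (arcs_pmf n p) \<subseteq> (\<lambda>S x. x \<in> S) ` Pow (arc_slots n)"
  proof
    fix b assume "b \<in> set_pmf (arcs_pmf n p)"
    then have "b = (\<lambda>x. x \<in> Collect b)" "Collect b \<in> Pow (arc_slots n)"
      using arcs_pmf_subset_slots by auto
    then show "b \<in> (\<lambda>S x. x \<in> S) ` Pow (arc_slots n)"
      by blast
  qed
qed simp

lemma random_digraph_eq:
  "random_digraph n p = map_pmf (\<lambda>b. \<lparr>pverts = {1..n}, parcs = Collect b\<rparr>) (arcs_pmf n p)"
  by (simp add: random_digraph_def arcs_pmf_def arc_slots_def)

lemma arcs_prob_indep:
  assumes "\<And>b b'. (\<And>e. e \<in> I \<Longrightarrow> b e = b' e) \<Longrightarrow> P b \<longleftrightarrow> P b'"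
    and "\<And>b b'. (\<And>e. e \<notin> I \<Longrightarrow> b e = b' e) \<Longrightarrow> Q b \<longleftrightarrow> Q b'"
  shows "arcs_prob n p (\<lambda>b. P b \<and> Q b) = arcs_prob n p P * arcs_prob n p Q"
  unfolding arcs_pmf_def by (rule prob_Pi_pmf_indep[of _ I]) (fact finite_arc_slots, fact assms(1), fact assms(2))

lemma arcs_prob_all_present:
  assumes "A \<subseteq> arc_slots n" "0 \<le> p" "p \<le> 1"
  shows "arcs_prob n p (\<lambda>b. A \<subseteq> Collect b) = p ^ card A"
proof -
  have "arcs_prob n p (\<lambda>b. A \<subseteq> Collect b) =
      measure_pmf.prob (arcs_pmf n p) (Pi (arc_slots n) (\<lambda>e. if e \<in> A then {True} else UNIV))"
    using assms(1) by (intro arg_cong2[where f = measure_pmf.prob]) (auto simp: Pi_def)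
  also have "\<dots> = (\<Prod>e\<in>arc_slots n. if e \<in> A then p else 1)"
    unfolding arcs_pmf_def using assms(2,3)
    by (subst measure_Pi_pmf_Pi) (auto intro!: prod.cong simp: measure_pmf_single)
  also have "\<dots> = p ^ card A"
    using assms(1) by (simp add: prod.If_cases Int_absorb1)
  finally show ?thesis .
qed

lemma arcs_prob_none_present:
  assumes "A \<subseteq> arc_slots n" "0 \<le> p" "p \<le> 1"
  shows "arcs_prob n p (\<lambda>b. A \<inter> Collect b = {}) = (1 - p) ^ card A"
proof -
  have "arcs_prob n p (\<lambda>b. A \<inter> Collect b = {}) =
      measure_pmf.prob (arcs_pmf n p) (Pi (arc_slots n) (\<lambda>e. if e \<in> A then {False} else UNIV))"
    using assms(1) by (intro arg_cong2[where f = measure_pmf.prob]) (auto simp: Pi_def)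
  also have "\<dots> = (\<Prod>e\<in>arc_slots n. if e \<in> A then 1 - p else 1)"
    unfolding arcs_pmf_def using assms(2,3)
    by (subst measure_Pi_pmf_Pi) (auto intro!: prod.cong simp: measure_pmf_single)
  also have "\<dots> = (1 - p) ^ card A"
    using assms(1) by (simp add: prod.If_cases Int_absorb1)
  finally show ?thesis .
qed

text \<open>Reversing all arcs preserves the law, so paths into a vertex are as likely as paths out
  of it.\<close>

lemma arcs_prob_swap: "arcs_prob n p (\<lambda>b. P (b \<circ> prod.swap)) = arcs_prob n p P"
proof -
  have "bij_betw prod.swap (arc_slots n) (arc_slots n)"
    by (rule bij_betwI[of _ _ _ prod.swap]) (auto simp: arc_slots_def)
  then have "arcs_pmf n p = map_pmf (\<lambda>b. b \<circ> prod.swap) (arcs_pmf n p)"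
    unfolding arcs_pmf_def
    by (intro Pi_pmf_bij_betw finite_arc_slots) (auto simp: arc_slots_def)
  then have "arcs_prob n p P = measure_pmf.prob (map_pmf (\<lambda>b. b \<circ> prod.swap) (arcs_pmf n p)) {b. P b}"
    by simp
  then show ?thesis
    by (simp add: vimage_def)
qed

lemma arcs_prob_mono:
  assumes "\<And>b. b \<in> set_pmf (arcs_pmf n p) \<Longrightarrow> P b \<Longrightarrow> Q b"
  shows "arcs_prob n p P \<le> arcs_prob n p Q"
  by (rule measure_pmf.finite_measure_mono_AE) (use assms in \<open>auto simp: AE_measure_pmf_iff\<close>)

lemma arcs_prob_Bex:
  assumes "finite S"
  shows "arcs_prob n p (\<lambda>b. \<exists>x\<in>S. P x b) \<le> (\<Sum>x\<in>S. arcs_prob n p (P x))"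
proof -
  have "{b. \<exists>x\<in>S. P x b} = (\<Union>x\<in>S. {b. P x b})" by auto
  then show ?thesis
    using measure_pmf.finite_measure_subadditive_finite[of S "\<lambda>x. {b. P x b}" "arcs_pmf n p"] assms
    by simp
qed

lemma arcs_prob_partition:
  assumes "finite S"
  shows "(\<Sum>U\<in>S. arcs_prob n p (\<lambda>b. N b = U \<and> Q b)) = arcs_prob n p (\<lambda>b. N b \<in> S \<and> Q b)"
proof -
  have "{b. N b \<in> S \<and> Q b} = (\<Union>U\<in>S. {b. N b = U \<and> Q b})" by auto
  moreover have "disjoint_family_on (\<lambda>U. {b. N b = U \<and> Q b}) S"
    by (auto simp: disjoint_family_on_def)
  ultimately show ?thesis
    using measure_pmf.finite_measure_finite_Union[of S "\<lambda>U. {b. N b = U \<and> Q b}" "arcs_pmf n p"] assms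
    by simp
qed

section \<open>Survival probabilities\<close>

text \<open>\<open>W\<close> holds the vertices not yet visited. For \<open>v\<close> outside
  \<open>W\<close> a continuation from \<open>u\<close> inspects only arcs with tails in
  \<open>W\<close>, hence is independent of the arcs leaving \<open>v\<close>.\<close>

fun has_path :: "('a \<times> 'a) set \<Rightarrow> nat \<Rightarrow> 'a \<Rightarrow> 'a set \<Rightarrow> bool" where
  "has_path A 0 v W \<longleftrightarrow> True"
| "has_path A (Suc h) v W \<longleftrightarrow> (\<exists>u\<in>W. (v, u) \<in> A \<and> has_path A h u (W - {u}))"

lemma has_path_cong:
  assumes "\<And>e. fst e \<in> insert v W \<Longrightarrow> e \<in> A \<longleftrightarrow> e \<in> B"
  shows "has_path A h v W \<longleftrightarrow> has_path B h v W"
  using assms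
proof (induction h arbitrary: v W)
  case (Suc h)
  have "has_path A h u (W - {u}) \<longleftrightarrow> has_path B h u (W - {u})" if "u \<in> W" for u
    by (rule Suc.IH) (use Suc.prems that in auto)
  then show ?case
    using Suc.prems by auto
qed simp

lemma has_path_mono: "A \<subseteq> B \<Longrightarrow> has_path A h v W \<Longrightarrow> has_path B h v W"
  by (induction h arbitrary: v W) auto

lemma has_pathI:
  assumes "\<And>i. i < h \<Longrightarrow> (f i, f (Suc i)) \<in> A" "inj_on f {..h}" "f ` {1..h} \<subseteq> W"
  shows "has_path A h (f 0) W"
  using assms
proof (induction h arbitrary: f W)
  case (Suc h)
  have "has_path A h ((f \<circ> Suc) 0) (W - {f 1})"
  proof (rule Suc.IH)
    show "((f \<circ> Suc) i, (f \<circ> Suc) (Suc i)) \<in> A" if "i < h" for i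
      using Suc.prems(1)[of "Suc i"] that by simp
    show "inj_on (f \<circ> Suc) {..h}"
      using Suc.prems(2) by (auto simp: inj_on_def)
    show "(f \<circ> Suc) ` {1..h} \<subseteq> W - {f 1}"
    proof safe
      fix x assume x: "x \<in> {1..h}"
      then show "(f \<circ> Suc) x \<in> W"
        using Suc.prems(3) by auto
      assume "(f \<circ> Suc) x = f 1"
      then show False
        using inj_onD[OF Suc.prems(2), of "Suc x" 1] x by simp
    qed
  qed
  moreover have "f 1 \<in> W"
    using Suc.prems(3) by auto
  ultimately show ?case
    using Suc.prems(1)[of 0] by auto
qed simp

text \<open>The number of suitable successors of \<open>v\<close> is independent of the arcs leaving \<open>v\<close>, and the
  convex function \<open>(1 - p) ^ k\<close> is bounded below by its tangent line at \<open>n * q\<close>.\<close>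

lemma has_path_Suc_prob:
  assumes W: "W \<subseteq> {1..n}" and v: "v \<in> {1..n} - W" and p: "0 \<le> p" "p < 1"
    and q: "\<And>u. u \<in> W \<Longrightarrow> arcs_prob n p (\<lambda>b. has_path (Collect b) h u (W - {u})) \<le> q"
    and q0: "0 \<le> q"
  shows "arcs_prob n p (\<lambda>b. has_path (Collect b) (Suc h) v W) \<le> 1 - exp (real n * q * ln (1 - p))"
proof -
  \<comment> \<open>A path of \<open>Suc h\<close> arcs exists exactly if \<open>v\<close> has an
    arc into \<open>N b\<close>, and \<open>N b\<close> itself does not depend on the arcs leaving
    \<open>v\<close>.\<close>
  define N where "N b = {u \<in> W. has_path (Collect b) h u (W - {u})}" for b
  define r where "r U = arcs_prob n p (\<lambda>b. N b = U)" for U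
  define m where "m = real n * q"
  define L where "L = ln (1 - p)"
  have [simp]: "finite W"
    using W finite_subset by blast
  have L: "L \<le> 0"
    using p by (simp add: L_def)
  have r0: "r U \<ge> 0" for U
    by (simp add: r_def)
  have sum_r: "(\<Sum>U\<in>Pow W. r U) = 1"
  proof -
    have "(\<Sum>U\<in>Pow W. r U) = arcs_prob n p (\<lambda>b. N b \<in> Pow W)"
      using arcs_prob_partition[of "Pow W" n p N "\<lambda>_. True"] by (simp add: r_def)
    also have "{b. N b \<in> Pow W} = UNIV"
      by (auto simp: N_def)
    finally show ?thesis
      by simp
  qed
  \<comment> \<open>Linearity of expectation: each vertex of \<open>W\<close> belongs to
    \<open>N b\<close> with probability at most \<open>q\<close>.\<close>
  have mean: "(\<Sum>U\<in>Pow W. r U * card U) \<le> m"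
  proof -
    have "(\<Sum>U\<in>Pow W. r U * card U) = (\<Sum>U\<in>Pow W. \<Sum>u\<in>W. arcs_prob n p (\<lambda>b. N b = U \<and> u \<in> N b))"
    proof (rule sum.cong[OF refl])
      fix U assume "U \<in> Pow W"
      then have U: "W \<inter> U = U" by auto
      have "arcs_prob n p (\<lambda>b. N b = U \<and> u \<in> N b) = (if u \<in> U then r U else 0)" for u
        by (auto simp: r_def intro!: arg_cong2[where f = measure_pmf.prob])
           (metis (mono_tags, lifting) empty_Collect_eq measure_empty)
      then show "r U * card U = (\<Sum>u\<in>W. arcs_prob n p (\<lambda>b. N b = U \<and> u \<in> N b))"
        by (simp add: sum.If_cases U)
    qed
    also have "\<dots> = (\<Sum>u\<in>W. arcs_prob n p (\<lambda>b. N b \<in> Pow W \<and> u \<in> N b))"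
      by (subst sum.swap, subst arcs_prob_partition) auto
    also have "\<dots> \<le> (\<Sum>u\<in>W. q)"
    proof (rule sum_mono)
      fix u assume u: "u \<in> W"
      have "arcs_prob n p (\<lambda>b. N b \<in> Pow W \<and> u \<in> N b)
          \<le> arcs_prob n p (\<lambda>b. has_path (Collect b) h u (W - {u}))"
        by (rule arcs_prob_mono) (auto simp: N_def)
      also have "\<dots> \<le> q" using q u .
      finally show "arcs_prob n p (\<lambda>b. N b \<in> Pow W \<and> u \<in> N b) \<le> q" .
    qed
    also have "\<dots> \<le> m"
      using card_mono[OF _ W] q0 by (simp add: m_def mult_right_mono)
    finally show ?thesis .
  qed
  have tangent: "(1 - p) ^ k \<ge> exp (m * L) * (1 + (real k - m) * L)" for k
  proof -
    have "(1 - p) ^ k = exp (real k * L)"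
      using p by (simp add: L_def exp_of_nat_mult)
    also have "\<dots> = exp (m * L) * exp ((real k - m) * L)"
      by (simp add: mult_exp_exp algebra_simps)
    also have "\<dots> \<ge> exp (m * L) * (1 + (real k - m) * L)"
      by (rule mult_left_mono[OF exp_ge_add_one_self]) simp
    finally show ?thesis .
  qed
  have "arcs_prob n p (\<lambda>b. has_path (Collect b) (Suc h) v W)
      \<le> arcs_prob n p (\<lambda>b. \<exists>U\<in>Pow W. N b = U \<and> \<not> ({v} \<times> U) \<inter> Collect b = {})"
    by (rule arcs_prob_mono) (auto simp: N_def)
  also have "\<dots> \<le> (\<Sum>U\<in>Pow W. arcs_prob n p (\<lambda>b. N b = U \<and> \<not> ({v} \<times> U) \<inter> Collect b = {}))"
    by (rule arcs_prob_Bex) simp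
  also have "\<dots> = (\<Sum>U\<in>Pow W. r U * (1 - (1 - p) ^ card U))"
  proof (rule sum.cong[OF refl])
    fix U assume U: "U \<in> Pow W"
    have sub: "{v} \<times> U \<subseteq> arc_slots n"
      using U W v by (auto simp: arc_slots_def)
    have "arcs_prob n p (\<lambda>b. N b = U \<and> \<not> ({v} \<times> U) \<inter> Collect b = {}) =
        r U * arcs_prob n p (\<lambda>b. \<not> ({v} \<times> U) \<inter> Collect b = {})"
      unfolding r_def
    proof (rule arcs_prob_indep[of "- ({v} \<times> UNIV)"])
      fix b b' :: "nat \<times> nat \<Rightarrow> bool"
      assume eq: "\<And>e. e \<in> - ({v} \<times> UNIV) \<Longrightarrow> b e = b' e"
      have "has_path (Collect b) h u (W - {u}) \<longleftrightarrow> has_path (Collect b') h u (W - {u})"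
        if "u \<in> W" for u
      proof (rule has_path_cong)
        fix e :: "nat \<times> nat" assume "fst e \<in> insert u (W - {u})"
        then have "e \<in> - ({v} \<times> UNIV)"
          using that v by (cases e) auto
        then show "e \<in> Collect b \<longleftrightarrow> e \<in> Collect b'"
          using eq by simp
      qed
      then have "N b = N b'" by (auto simp: N_def)
      then show "N b = U \<longleftrightarrow> N b' = U" by simp
    qed auto
    also have "arcs_prob n p (\<lambda>b. \<not> ({v} \<times> U) \<inter> Collect b = {}) =
        1 - arcs_prob n p (\<lambda>b. ({v} \<times> U) \<inter> Collect b = {})"
      using measure_pmf.prob_neg[where M = "arcs_pmf n p" and P = "\<lambda>b. ({v} \<times> U) \<inter> Collect b = {}"] by simp
    also have "\<dots> = 1 - (1 - p) ^ card U"
      using arcs_prob_none_present[OF sub] p by (simp add: card_cartesian_product)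
    finally show "arcs_prob n p (\<lambda>b. N b = U \<and> \<not> ({v} \<times> U) \<inter> Collect b = {}) =
        r U * (1 - (1 - p) ^ card U)" .
  qed
  also have "\<dots> \<le> (\<Sum>U\<in>Pow W. r U * (1 - exp (m * L) * (1 + (real (card U) - m) * L)))"
    by (intro sum_mono mult_left_mono r0) (simp add: tangent)
  also have "\<dots> = (\<Sum>U\<in>Pow W. r U * (1 - exp (m * L) * (1 - m * L)) - exp (m * L) * L * (r U * card U))"
    by (rule sum.cong) (auto simp: algebra_simps)
  also have "\<dots> = (1 - exp (m * L) * (1 - m * L)) - exp (m * L) * L * (\<Sum>U\<in>Pow W. r U * card U)"
    by (simp add: sum_subtractf sum_r flip: sum_distrib_left sum_distrib_right)
  \<comment> \<open>Since \<open>L \<le> 0\<close>, the upper bound on the mean size may be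
    inserted; the terms linear in \<open>m\<close> then cancel.\<close>
  also have "\<dots> \<le> (1 - exp (m * L) * (1 - m * L)) - exp (m * L) * L * m"
    by (intro diff_left_mono mult_left_mono_neg mean) (use L in \<open>simp add: mult_nonneg_nonpos\<close>)
  also have "\<dots> = 1 - exp (real n * q * ln (1 - p))"
    by (simp add: algebra_simps m_def L_def)
  finally show ?thesis .
qed

text \<open>The difference of the two sides, cleared of denominators, vanishes at 0 and is
  nondecreasing because \<open>1 + x \<le> exp x\<close>. The reciprocal form makes the recursion
  for survival probabilities additive: at mean 1 each generation adds at least 1/2 to the
  reciprocal.\<close>

lemma one_minus_exp_minus_le:
  fixes y :: real
  assumes "0 < y"
  shows "1 - exp (- y) \<le> 1 / (1 / y + 1 / 2)"
proof -
  let ?g = "\<lambda>y::real. y - (1 + y / 2) * (1 - exp (- y))"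
  have "?g 0 \<le> ?g y"
  proof (rule DERIV_nonneg_imp_nondecreasing[OF less_imp_le[OF assms]])
    fix x :: real assume x: "0 \<le> x" "x \<le> y"
    have "(?g has_real_derivative (1 / 2 - exp (- x) * (1 + x) / 2)) (at x)"
      by (auto intro!: derivative_eq_intros simp: field_simps)
    moreover have "exp (- x) * (1 + x) \<le> 1"
      using exp_ge_add_one_self[of x] by (simp add: exp_minus field_simps)
    ultimately show "\<exists>d. (?g has_real_derivative d) (at x) \<and> 0 \<le> d"
      by (intro exI[of _ "1 / 2 - exp (- x) * (1 + x) / 2"]) simp
  qed
  then show ?thesis
    using assms by (simp add: field_simps)
qed

text \<open>This is the survival bound for a branching process with Poisson offspring of mean at
  most \<open>\<mu>\<close>: at mean 1 the reciprocals grow by 1/2 per generation, which gives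
  \<open>2 / h\<close>, and in general each generation costs one further factor
  \<open>\<mu>\<close>.\<close>

lemma has_path_prob:
  assumes p: "0 \<le> p" "p < 1" and \<mu>: "1 \<le> \<mu>" "- (real n * ln (1 - p)) \<le> \<mu>"
    and "1 \<le> h" "W \<subseteq> {1..n}" "v \<in> {1..n} - W"
  shows "arcs_prob n p (\<lambda>b. has_path (Collect b) h v W) \<le> 2 * \<mu> ^ h / real h"
  using assms(5-7)
proof (induction h arbitrary: v W rule: nat_induct_at_least)
  case base
  have "arcs_prob n p (\<lambda>b. has_path (Collect b) 1 v W) \<le> 1"
    by simp
  also have "\<dots> \<le> 2 * \<mu> ^ 1 / real 1"
    using \<mu> by simp
  finally show ?case .
next
  case (Suc h)
  define q where "q = 2 * \<mu> ^ h / real h"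
  define y where "y = \<mu> * q"
  have q: "q > 0" "y > 0"
    using \<mu> Suc.hyps by (simp_all add: q_def y_def)
  have "arcs_prob n p (\<lambda>b. has_path (Collect b) (Suc h) v W) \<le> 1 - exp (real n * q * ln (1 - p))"
  proof (rule has_path_Suc_prob)
    show "arcs_prob n p (\<lambda>b. has_path (Collect b) h u (W - {u})) \<le> q" if "u \<in> W" for u
      unfolding q_def by (rule Suc.IH) (use Suc.prems that in auto)
  qed (use Suc.prems p q in auto)
  also have "\<dots> \<le> 1 - exp (- y)"
    using mult_right_mono[OF \<mu>(2), of q] q by (simp add: y_def algebra_simps)
  also have "\<dots> \<le> 1 / (1 / y + 1 / 2)"
    by (rule one_minus_exp_minus_le) (use q in simp)
  also have "\<dots> \<le> 1 / (real (Suc h) / (2 * \<mu> ^ Suc h))"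
  proof (rule divide_left_mono)
    \<comment> \<open>The first \<open>h\<close> units of the numerator make up
      \<open>1 / y\<close>; the last one contributes at most 1/2 because
      \<open>1 \<le> \<mu>\<close>.\<close>
    have "real (Suc h) / (2 * \<mu> ^ Suc h) = 1 / y + 1 / (2 * \<mu> ^ Suc h)"
      using \<mu> Suc.hyps by (simp add: y_def q_def field_simps)
    also have "1 / (2 * \<mu> ^ Suc h) \<le> 1 / 2"
      using one_le_power[OF \<mu>(1), of "Suc h"] by (simp add: field_simps)
    finally show "real (Suc h) / (2 * \<mu> ^ Suc h) \<le> 1 / y + 1 / 2" by simp
    show "0 < (1 / y + 1 / 2) * (real (Suc h) / (2 * \<mu> ^ Suc h))"
      using q \<mu> by (intro mult_pos_pos divide_pos_pos add_pos_pos) auto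
  qed simp
  also have "\<dots> = 2 * \<mu> ^ Suc h / real (Suc h)"
    by simp
  finally show ?case .
qed

section \<open>Cycles, balls and shortest closed walks\<close>

definition cyc :: "'a list \<Rightarrow> ('a \<times> 'a) set" where
  "cyc xs = set (zip xs (rotate1 xs))"

lemma cyc_conv_nth: "cyc xs = {(xs ! i, xs ! (Suc i mod length xs)) | i. i < length xs}"
  by (auto simp: cyc_def set_zip nth_rotate1)

lemma card_cyc: "distinct xs \<Longrightarrow> card (cyc xs) = length xs"
  by (simp add: cyc_def distinct_card distinct_zipI1)

lemma cyc_subset_arc_slots:
  assumes "distinct xs" "2 \<le> length xs" "set xs \<subseteq> {1..n}"
  shows "cyc xs \<subseteq> arc_slots n"
proof -
  have "xs ! i \<noteq> xs ! (Suc i mod length xs)" if "i < length xs" for i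
  proof -
    have "Suc i mod length xs = (if Suc i = length xs then 0 else Suc i)"
      using that by auto
    then have "Suc i mod length xs \<noteq> i" "Suc i mod length xs < length xs"
      using that assms(2) by (auto split: if_splits)
    then show ?thesis
      using assms(1) that by (metis nth_eq_iff_index_eq)
  qed
  moreover have "xs ! i \<in> {1..n}" if "i < length xs" for i
    using assms(3) that nth_mem by blast
  moreover have "Suc i mod length xs < length xs" for i
    using assms(2) by (intro mod_less_divisor) auto
  ultimately show ?thesis
    unfolding cyc_conv_nth arc_slots_def by blast
qed

lemma cyc_prob:
  assumes "distinct xs" "2 \<le> length xs" "set xs \<subseteq> {1..n}" "0 \<le> p" "p \<le> 1"
  shows "arcs_prob n p (\<lambda>b. cyc xs \<subseteq> Collect b) = p ^ length xs"
  using arcs_prob_all_present[OF cyc_subset_arc_slots] assms by (simp add: card_cyc)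

text \<open>The strict inequality gives radius \<open>h - 1\<close>: a path of \<open>h\<close> arcs
  from \<open>v\<close> has all its tails in the ball, while its endpoint may lie outside.\<close>

definition ball_within :: "('a \<times> 'a) set \<Rightarrow> 'a \<Rightarrow> nat \<Rightarrow> 'a set" where
  "ball_within A v h = {u. \<exists>j<h. (v, u) \<in> A ^^ j}"

text \<open>Exploring the ball uses only arcs that leave its own vertices, so the event that the
  ball equals \<open>S\<close> is decided by the arcs with tails in \<open>S\<close>.\<close>

lemma ball_within_cong:
  assumes eq: "\<And>e. fst e \<in> S \<Longrightarrow> e \<in> A \<longleftrightarrow> e \<in> B"
  shows "ball_within A v h = S \<longleftrightarrow> ball_within B v h = S"
proof -
  have "ball_within B v h = S" if eq: "\<And>e. fst e \<in> S \<Longrightarrow> e \<in> A \<longleftrightarrow> e \<in> B"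
    and A: "ball_within A v h = S" for A B
  proof -
    have "\<forall>u. (v, u) \<in> A ^^ j \<longleftrightarrow> (v, u) \<in> B ^^ j" if "j < h" for j
      using that
    proof (induction j)
      case (Suc j)
      have "w \<in> S" if "(v, w) \<in> A ^^ j" for w
        using A that Suc.prems by (auto simp: ball_within_def intro: Suc_lessD)
      then show ?case
        using Suc eq by (auto simp: relcomp_unfold)
    qed auto
    then show ?thesis
      using A by (auto simp: ball_within_def)
  qed
  from this[of A B] this[of B A] eq show ?thesis by blast
qed

text \<open>A shortest closed walk is a cycle.  If it is long, then its first \<open>h\<close> arcs have their tails in the
  ball of radius \<open>h - 1\<close> around \<open>v\<close>, and its last \<open>h\<close> arcs have their tails outside that ball, since
  otherwise there would be a shorter closed walk.\<close>

lemma closed_walk_cases: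
  fixes A :: "('a \<times> 'a) set"
  assumes "(v, v) \<in> A\<^sup>+" "A \<subseteq> V \<times> V" and h: "1 \<le> h"
  defines "S \<equiv> ball_within A v h"
  obtains (short) xs where "xs \<noteq> []" "hd xs = v" "distinct xs" "set xs \<subseteq> V" "cyc xs \<subseteq> A"
      "length xs \<le> 2 * h"
  | (long) "has_path (A \<inter> S \<times> UNIV) h v (V - {v})" "has_path ((A \<inter> (- S) \<times> UNIV)\<inverse>) h v (V - {v})"
proof -
  define l where "l = (LEAST l. 0 < l \<and> (v, v) \<in> A ^^ l)"
  have "\<exists>l. 0 < l \<and> (v, v) \<in> A ^^ l"
    using assms(1) by (auto simp: trancl_power)
  then have l: "0 < l" "(v, v) \<in> A ^^ l"
    unfolding l_def by (metis (mono_tags, lifting) LeastI_ex)+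
  have min: "l \<le> k" if "0 < k" "(v, v) \<in> A ^^ k" for k
    unfolding l_def by (rule Least_le) (use that in simp)
  from l(2) obtain f where f: "f 0 = v" "f l = v" "\<And>i. i < l \<Longrightarrow> (f i, f (Suc i)) \<in> A"
    by (auto simp: relpow_fun_conv)
  have walk: "(f i, f j) \<in> A ^^ (j - i)" if "i \<le> j" "j \<le> l" for i j
    unfolding relpow_fun_conv
    by (rule exI[of _ "\<lambda>k. f (i + k)"]) (use that f(3) in auto)
  \<comment> \<open>Cutting out the segment between two equal vertices leaves a closed walk of
    length \<open>i + (l - j)\<close>, shorter than \<open>l\<close>, unless the segment is the
    whole walk.\<close>
  have inj: "i = 0 \<and> j = l" if "f i = f j" "i < j" "j \<le> l" for i j
  proof (rule ccontr)
    assume neg: "\<not> (i = 0 \<and> j = l)"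
    have "(v, v) \<in> A ^^ (i + (l - j))"
      using relpow_trans[OF walk[of 0 i] walk[of j l, folded that(1)]] that f by simp
    then have "l \<le> i + (l - j)"
      by (rule min[rotated]) (use neg that in auto)
    then show False
      using that by simp
  qed
  have V: "f i \<in> V" if "i \<le> l" for i
    using f(3)[of i] f(3)[of 0] f(1,2) assms(2) that l(1) by (cases "i = l") auto
  show ?thesis
  proof (cases "l \<le> 2 * h")
    case True
    let ?xs = "map f [0..<l]"
    have "distinct ?xs"
      by (auto simp: distinct_map inj_on_def) (metis inj linorder_neqE_nat order_less_imp_le order_less_irrefl)
    moreover have "cyc ?xs \<subseteq> A"
    proof -
      have "f (Suc i mod l) = f (Suc i)" if "i < l" for i
        using that f(1,2) by (cases "Suc i = l") auto
      then show ?thesis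
        using f(3) l(1) by (auto simp: cyc_conv_nth)
    qed
    ultimately show ?thesis
      using l(1) f(1) V True by (intro short[of ?xs]) (auto simp: hd_map)
  next
    case False
    have S: "f i \<in> S" if "i < h" for i
      unfolding S_def ball_within_def using walk[of 0 i] f(1) that False by auto
    \<comment> \<open>A ball vertex is reached in \<open>j < h\<close> steps, and at most
      \<open>h\<close> final arcs lead from it back to \<open>v\<close>; the resulting closed walk
      would have fewer than \<open>2 * h\<close> arcs, against the minimality of
      \<open>l\<close>.\<close>
    have notS: "f (l - Suc i) \<notin> S" if "i < h" for i
    proof
      assume "f (l - Suc i) \<in> S"
      then obtain j where j: "j < h" "(v, f (l - Suc i)) \<in> A ^^ j"
        by (auto simp: S_def ball_within_def)
      have "(f (l - Suc i), v) \<in> A ^^ (Suc i)"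
        using walk[of "l - Suc i" l] f(2) that False by simp
      with j(2) have "(v, v) \<in> A ^^ (j + Suc i)"
        by (rule relpow_trans)
      then have "l \<le> j + Suc i"
        by (rule min[rotated]) simp
      then show False
        using that j(1) False by simp
    qed
    have "has_path (A \<inter> S \<times> UNIV) h (f 0) (V - {v})"
    proof (rule has_pathI)
      show "inj_on f {..h}"
      proof (rule linorder_inj_onI)
        fix i j assume "i < j" "i \<in> {..h}" "j \<in> {..h}"
        then show "f i \<noteq> f j"
          using inj[of i j] False by auto
      qed auto
      show "f ` {1..h} \<subseteq> V - {v}"
      proof (rule image_subsetI)
        fix i assume i: "i \<in> {1..h}"
        then have "f 0 \<noteq> f i"
          using inj[of 0 i] False by auto
        then show "f i \<in> V - {v}"
          using V[of i] f(1) i False by simp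
      qed
    qed (use f(3) S False in auto)
    moreover have "has_path ((A \<inter> (- S) \<times> UNIV)\<inverse>) h (f (l - 0)) (V - {v})"
    proof (rule has_pathI[where f = "\<lambda>i. f (l - i)"])
      show "inj_on (\<lambda>i. f (l - i)) {..h}"
      proof (rule linorder_inj_onI)
        fix i j assume "i < j" "i \<in> {..h}" "j \<in> {..h}"
        then have "l - j < l - i" "l - j \<noteq> 0"
          using False by auto
        then show "f (l - i) \<noteq> f (l - j)"
          using inj[of "l - j" "l - i"] diff_le_self[of l i] by metis
      qed auto
      show "(\<lambda>i. f (l - i)) ` {1..h} \<subseteq> V - {v}"
      proof (rule image_subsetI)
        fix i assume i: "i \<in> {1..h}"
        then have "f (l - i) \<noteq> f l"
          using inj[of "l - i" l] l(1) False by auto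
        then show "f (l - i) \<in> V - {v}"
          using V[of "l - i"] f(2) by simp
      qed
      show "(f (l - i), f (l - Suc i)) \<in> (A \<inter> (- S) \<times> UNIV)\<inverse>" if "i < h" for i
      proof -
        have "Suc (l - Suc i) = l - i"
          using that False by simp
        then show ?thesis
          using f(3)[of "l - Suc i"] notS[OF that] that False by simp
      qed
    qed
    ultimately show ?thesis
      using f(1,2) by (intro long) auto
  qed
qed

section \<open>Vertices on closed walks\<close>

text \<open>Union bound over the two cases of \<open>closed_walk_cases\<close>. The sum bounds the
  expected number of cycles through \<open>v\<close> with at most \<open>2 * h\<close> arcs; the
  square comes from two long paths that use disjoint sets of arcs once the ball is fixed.\<close>

lemma closed_walk_prob:
  assumes p: "0 \<le> p" "p < 1" and \<mu>: "1 \<le> \<mu>" "- (real n * ln (1 - p)) \<le> \<mu>"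
    and h: "1 \<le> h" and v: "v \<in> {1..n}"
  shows "arcs_prob n p (\<lambda>b. (v, v) \<in> (Collect b)\<^sup>+)
      \<le> (\<Sum>l=2..2*h. real n ^ (l - 1) * p ^ l) + (2 * \<mu> ^ h / real h)\<^sup>2"
proof -
  \<comment> \<open>Listing a cycle from \<open>v\<close> onwards counts it once and leaves
    \<open>l - 1\<close> free vertices.\<close>
  define L where "L l = {xs. set xs \<subseteq> {1..n} \<and> length xs = l \<and> distinct xs \<and> xs \<noteq> [] \<and> hd xs = v}" for l
  define W where "W = {1..n} - {v}"
  define B where "B b = ball_within (Collect b) v h" for b :: "nat \<times> nat \<Rightarrow> bool"
  define R where "R S b \<longleftrightarrow> has_path ((Collect b \<inter> (- S) \<times> UNIV)\<inverse>) h v W"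
    for S and b :: "nat \<times> nat \<Rightarrow> bool"
  define F where "F S b \<longleftrightarrow> has_path (Collect b \<inter> S \<times> UNIV) h v W"
    for S and b :: "nat \<times> nat \<Rightarrow> bool"
  define \<S> where "\<S> = B ` set_pmf (arcs_pmf n p)"
  define g where "g = 2 * \<mu> ^ h / real h"
  have g0: "g \<ge> 0"
    using \<mu> by (simp add: g_def)
  have fin: "finite (L l)" for l
    by (rule finite_subset[OF _ finite_lists_length_eq[of "{1..n}" l]]) (auto simp: L_def)
  have cardL: "real (card (L l)) \<le> real n ^ (l - 1)" for l
  proof -
    have "L l \<subseteq> (#) v ` {ys. set ys \<subseteq> {1..n} \<and> length ys = l - 1}"
    proof
      fix xs assume "xs \<in> L l"
      then show "xs \<in> (#) v ` {ys. set ys \<subseteq> {1..n} \<and> length ys = l - 1}"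
        by (cases xs) (auto simp: L_def)
    qed
    then have "card (L l) \<le> card ((#) v ` {ys. set ys \<subseteq> {1..n} \<and> length ys = l - 1})"
      by (intro card_mono finite_imageI finite_lists_length_eq) auto
    also have "\<dots> \<le> card {ys. set ys \<subseteq> {1..n} \<and> length ys = l - 1}"
      by (rule card_image_le) (auto intro: finite_lists_length_eq)
    also have "\<dots> = n ^ (l - 1)"
      by (simp add: card_lists_length_eq)
    finally have "real (card (L l)) \<le> real (n ^ (l - 1))"
      by (rule of_nat_mono)
    then show ?thesis by simp
  qed
  have short: "arcs_prob n p (\<lambda>b. \<exists>l\<in>{2..2*h}. \<exists>xs\<in>L l. cyc xs \<subseteq> Collect b)
      \<le> (\<Sum>l=2..2*h. real n ^ (l - 1) * p ^ l)"
  proof -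
    have "arcs_prob n p (\<lambda>b. \<exists>l\<in>{2..2*h}. \<exists>xs\<in>L l. cyc xs \<subseteq> Collect b)
        \<le> (\<Sum>l=2..2*h. arcs_prob n p (\<lambda>b. \<exists>xs\<in>L l. cyc xs \<subseteq> Collect b))"
      by (rule arcs_prob_Bex) simp
    also have "\<dots> \<le> (\<Sum>l=2..2*h. \<Sum>xs\<in>L l. arcs_prob n p (\<lambda>b. cyc xs \<subseteq> Collect b))"
      by (intro sum_mono arcs_prob_Bex fin)
    also have "\<dots> = (\<Sum>l=2..2*h. \<Sum>xs\<in>L l. p ^ l)"
    proof (intro sum.cong refl)
      fix l xs assume "l \<in> {2..2*h}" "xs \<in> L l"
      then show "arcs_prob n p (\<lambda>b. cyc xs \<subseteq> Collect b) = p ^ l"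
        using cyc_prob[of xs n p] p by (auto simp: L_def)
    qed
    also have "\<dots> \<le> (\<Sum>l=2..2*h. real n ^ (l - 1) * p ^ l)"
    proof (rule sum_mono)
      fix l
      show "(\<Sum>xs\<in>L l. p ^ l) \<le> real n ^ (l - 1) * p ^ l"
        using mult_right_mono[OF cardL, of "p ^ l" l] p by simp
    qed
    finally show ?thesis .
  qed
  have path: "arcs_prob n p (\<lambda>b. has_path (Collect b) h v W) \<le> g"
    unfolding g_def by (rule has_path_prob) (use p \<mu> h v in \<open>auto simp: W_def\<close>)
  have R: "arcs_prob n p (R S) \<le> g" for S
  proof -
    \<comment> \<open>Dropping the restriction on tails and reversing every arc turns a path into
      \<open>v\<close> into a path out of \<open>v\<close>.\<close>
    have "arcs_prob n p (R S) \<le> arcs_prob n p (\<lambda>b. has_path (Collect (b \<circ> prod.swap)) h v W)"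
    proof (rule arcs_prob_mono)
      fix b assume R: "R S b"
      have "(Collect b \<inter> (- S) \<times> UNIV)\<inverse> \<subseteq> Collect (b \<circ> prod.swap)"
        by auto
      from has_path_mono[OF this R[unfolded R_def]]
      show "has_path (Collect (b \<circ> prod.swap)) h v W" .
    qed
    also have "\<dots> = arcs_prob n p (\<lambda>b. has_path (Collect b) h v W)"
      by (rule arcs_prob_swap)
    finally show ?thesis
      using path by simp
  qed
  \<comment> \<open>Both \<open>B b = S\<close> and \<open>F S b\<close> are decided by the arcs
    with tails in \<open>S\<close>, while \<open>R S b\<close> sees only the others.\<close>
  have indep: "arcs_prob n p (\<lambda>b. (B b = S \<and> F S b) \<and> R S b) =
      arcs_prob n p (\<lambda>b. B b = S \<and> F S b) * arcs_prob n p (R S)" for S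
  proof (rule arcs_prob_indep[of "S \<times> UNIV"])
    fix b b' :: "nat \<times> nat \<Rightarrow> bool"
    assume eq: "\<And>e. e \<in> S \<times> UNIV \<Longrightarrow> b e = b' e"
    have "B b = S \<longleftrightarrow> B b' = S"
      unfolding B_def by (rule ball_within_cong) (use eq in \<open>auto simp: mem_Times_iff\<close>)
    moreover have "Collect b \<inter> S \<times> UNIV = Collect b' \<inter> S \<times> UNIV"
      using eq by blast
    then have "F S b = F S b'" by (simp add: F_def)
    ultimately show "B b = S \<and> F S b \<longleftrightarrow> B b' = S \<and> F S b'" by simp
  next
    fix b b' :: "nat \<times> nat \<Rightarrow> bool"
    assume eq: "\<And>e. e \<notin> S \<times> UNIV \<Longrightarrow> b e = b' e"
    have "Collect b \<inter> (- S) \<times> UNIV = Collect b' \<inter> (- S) \<times> UNIV"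
      using eq by blast
    then show "R S b = R S b'" by (simp add: R_def)
  qed
  have long: "arcs_prob n p (\<lambda>b. \<exists>S\<in>\<S>. (B b = S \<and> F S b) \<and> R S b) \<le> g\<^sup>2"
  proof -
    have "arcs_prob n p (\<lambda>b. \<exists>S\<in>\<S>. (B b = S \<and> F S b) \<and> R S b)
        \<le> (\<Sum>S\<in>\<S>. arcs_prob n p (\<lambda>b. (B b = S \<and> F S b) \<and> R S b))"
      by (rule arcs_prob_Bex) (simp add: \<S>_def)
    \<comment> \<open>The probability of \<open>R S\<close> is at most \<open>g\<close> uniformly in
      \<open>S\<close>; the other factors belong to disjoint events and sum to at most one more
      \<open>g\<close>.\<close>
    also have "\<dots> \<le> (\<Sum>S\<in>\<S>. arcs_prob n p (\<lambda>b. B b = S \<and> has_path (Collect b) h v W) * g)"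
    proof (rule sum_mono)
      fix S
      have "arcs_prob n p (\<lambda>b. B b = S \<and> F S b)
          \<le> arcs_prob n p (\<lambda>b. B b = S \<and> has_path (Collect b) h v W)"
        by (rule arcs_prob_mono) (auto simp: F_def intro: has_path_mono[rotated])
      then show "arcs_prob n p (\<lambda>b. (B b = S \<and> F S b) \<and> R S b)
          \<le> arcs_prob n p (\<lambda>b. B b = S \<and> has_path (Collect b) h v W) * g"
        unfolding indep by (intro mult_mono R) auto
    qed
    also have "\<dots> = arcs_prob n p (\<lambda>b. B b \<in> \<S> \<and> has_path (Collect b) h v W) * g"
      by (subst sum_distrib_right[symmetric], subst arcs_prob_partition) (simp_all add: \<S>_def)
    also have "\<dots> \<le> arcs_prob n p (\<lambda>b. has_path (Collect b) h v W) * g"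
      by (intro mult_right_mono arcs_prob_mono g0) auto
    also have "\<dots> \<le> g\<^sup>2"
      using path g0 by (simp add: power2_eq_square mult_right_mono)
    finally show ?thesis .
  qed
  have "arcs_prob n p (\<lambda>b. (v, v) \<in> (Collect b)\<^sup>+) \<le> arcs_prob n p (\<lambda>b.
      (\<exists>l\<in>{2..2*h}. \<exists>xs\<in>L l. cyc xs \<subseteq> Collect b) \<or> (\<exists>S\<in>\<S>. (B b = S \<and> F S b) \<and> R S b))"
  proof (rule arcs_prob_mono)
    fix b assume b: "b \<in> set_pmf (arcs_pmf n p)" and closed: "(v, v) \<in> (Collect b)\<^sup>+"
    have slots: "Collect b \<subseteq> arc_slots n"
      using b by (rule arcs_pmf_subset_slots)
    then have "Collect b \<subseteq> {1..n} \<times> {1..n}"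
      by (auto simp: arc_slots_def)
    from closed this h show "(\<exists>l\<in>{2..2*h}. \<exists>xs\<in>L l. cyc xs \<subseteq> Collect b) \<or>
        (\<exists>S\<in>\<S>. (B b = S \<and> F S b) \<and> R S b)"
    proof (cases rule: closed_walk_cases)
      case (short xs)
      \<comment> \<open>A singleton list would make \<open>cyc xs\<close> a loop, and
        \<open>arc_slots\<close> contains none.\<close>
      have "length xs \<noteq> 1"
      proof
        assume "length xs = 1"
        then have "xs = [v]"
          using short(2) by (cases xs) auto
        then have "(v, v) \<in> arc_slots n"
          using short(5) slots by (auto simp: cyc_def)
        then show False by (simp add: arc_slots_def)
      qed
      moreover have "length xs \<noteq> 0"
        using short(1) by simp
      ultimately have "2 \<le> length xs"
        by linarith
      with short have "length xs \<in> {2..2*h}" "xs \<in> L (length xs)"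
        by (auto simp: L_def)
      with short(5) show ?thesis by blast
    next
      case long
      then show ?thesis
        using b by (auto simp: \<S>_def F_def R_def B_def W_def)
    qed
  qed
  also have "\<dots> \<le> arcs_prob n p (\<lambda>b. \<exists>l\<in>{2..2*h}. \<exists>xs\<in>L l. cyc xs \<subseteq> Collect b) +
      arcs_prob n p (\<lambda>b. \<exists>S\<in>\<S>. (B b = S \<and> F S b) \<and> R S b)"
    unfolding Collect_disj_eq by (rule measure_Un_le) auto
  finally show ?thesis
    using short long unfolding g_def by linarith
qed

section \<open>Strong components, cycles and vertices on closed walks\<close>

lemma cyc_trancl:
  assumes "cyc xs \<subseteq> A" "x \<in> set xs" "y \<in> set xs"
  shows "(x, y) \<in> A\<^sup>+"
proof -
  let ?l = "length xs"
  obtain i j where ij: "i < ?l" "x = xs ! i" "j < ?l" "y = xs ! j"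
    using assms(2,3) by (auto simp: in_set_conv_nth)
  have "(xs ! i, xs ! ((i + k) mod ?l)) \<in> A ^^ k" for k
  proof (induction k)
    case 0
    then show ?case using ij by simp
  next
    case (Suc k)
    have "(i + k) mod ?l < ?l"
      using ij(1) by (intro mod_less_divisor) auto
    then have "(xs ! ((i + k) mod ?l), xs ! (Suc ((i + k) mod ?l) mod ?l)) \<in> A"
      using assms(1) by (auto simp: cyc_conv_nth)
    then have "(xs ! ((i + k) mod ?l), xs ! ((i + Suc k) mod ?l)) \<in> A"
      by (simp add: mod_Suc_eq)
    then show ?case
      using Suc by auto
  qed
  \<comment> \<open>Going \<open>?l + j - i\<close> steps forward ends at index \<open>j\<close> and
    is a positive number of steps even if \<open>i = j\<close>, as the transitive closure
    requires.\<close>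
  from this[of "?l + j - i"] have "(x, y) \<in> A ^^ (?l + j - i)"
    using ij by simp
  then show ?thesis
    using ij by (auto simp: trancl_power intro!: exI[of _ "?l + j - i"])
qed

lemma largest_scc_size_eq:
  assumes "pair_digraph G"
  shows "largest_scc_size G = Max ((\<lambda>u. card (pre_digraph.scc_of (with_proj G) u)) ` pverts G)"
proof -
  interpret pair_digraph G by fact
  have "pre_digraph.sccs (with_proj G) =
      (\<lambda>u. induce_subgraph (with_proj G) (scc_of u)) ` pverts G"
    unfolding sccs_conv_sccs_verts sccs_verts_conv_scc_of by (simp add: image_image)
  then show ?thesis
    by (simp add: largest_scc_size_def image_image)
qed

lemma largest_scc_size_ge_cycle:
  assumes "pair_digraph G" "distinct xs" "xs \<noteq> []" "set xs \<subseteq> pverts G" "cyc xs \<subseteq> parcs G"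
  shows "length xs \<le> largest_scc_size G"
proof -
  interpret pair_digraph G by fact
  have x: "hd xs \<in> pverts G" "hd xs \<in> set xs"
    using assms(3,4) by auto
  have "set xs \<subseteq> scc_of (hd xs)"
    using cyc_trancl[OF assms(5)] x(2) by (auto simp: scc_of_def)
  moreover have "finite (scc_of (hd xs))"
    by (rule finite_subset[of _ "pverts G"]) (auto simp: scc_of_def dest: reachable_in_verts(2))
  ultimately have "card (set xs) \<le> card (scc_of (hd xs))"
    by (intro card_mono)
  also have "\<dots> \<le> largest_scc_size G"
    unfolding largest_scc_size_eq[OF assms(1)] using x(1) by (intro Max_ge) auto
  finally show ?thesis
    using assms(2) by (simp add: distinct_card)
qed

text \<open>In a component with at least two vertices every vertex lies on a closed walk;
  \<open>max 1\<close> covers the singleton components.\<close>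

lemma largest_scc_size_le:
  assumes "pair_digraph G" "pverts G \<noteq> {}"
  shows "largest_scc_size G \<le> max 1 (card {u \<in> pverts G. (u, u) \<in> (parcs G)\<^sup>+})"
proof -
  interpret pair_digraph G by fact
  have "card (scc_of u) \<le> max 1 (card {u \<in> pverts G. (u, u) \<in> (parcs G)\<^sup>+})" for u
  proof (cases "scc_of u \<subseteq> {u}")
    case True
    then show ?thesis
      using card_mono[OF _ True] by simp
  next
    case False
    then obtain w where w: "w \<noteq> u" "u \<rightarrow>\<^sup>*\<^bsub>G\<^esub> w" "w \<rightarrow>\<^sup>*\<^bsub>G\<^esub> u"
      by (auto simp: scc_of_def)
    have "(x, x) \<in> (parcs G)\<^sup>+ \<and> x \<in> pverts G" if x: "u \<rightarrow>\<^sup>*\<^bsub>G\<^esub> x" "x \<rightarrow>\<^sup>*\<^bsub>G\<^esub> u" for x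
    proof -
      \<comment> \<open>Since \<open>u\<close> and \<open>w\<close> differ, one of them differs from
        \<open>x\<close>; the round trip to it is the closed walk.\<close>
      obtain y where y: "y \<noteq> x" "x \<rightarrow>\<^sup>*\<^bsub>G\<^esub> y" "y \<rightarrow>\<^sup>*\<^bsub>G\<^esub> x"
        using w x by metis
      then have "(x, x) \<in> (parcs G)\<^sup>+"
        using reachable_neq_reachable1[of x y] reachable_neq_reachable1[of y x]
        by (auto intro: trancl_trans)
      then show ?thesis
        using x(2) reachable_in_verts(1)[of x u] by simp
    qed
    then have "scc_of u \<subseteq> {u \<in> pverts G. (u, u) \<in> (parcs G)\<^sup>+}"
      by (auto simp: scc_of_def)
    then have "card (scc_of u) \<le> card {u \<in> pverts G. (u, u) \<in> (parcs G)\<^sup>+}"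
      by (intro card_mono) auto
    then show ?thesis by simp
  qed
  then show ?thesis
    unfolding largest_scc_size_eq[OF assms(1)] using assms(2) by (subst Max_le_iff) auto
qed

lemma pair_digraph_arcs_pmf:
  assumes "b \<in> set_pmf (arcs_pmf n p)"
  shows "pair_digraph \<lparr>pverts = {1..n}, parcs = Collect b\<rparr>"
  by (rule pair_digraph_random_digraph[of _ n p]) (use assms in \<open>auto simp: random_digraph_eq\<close>)

text \<open>Markov's inequality for the number of vertices on closed walks; \<open>1 \<le> x\<close>
  disposes of singleton components.\<close>

lemma largest_scc_size_upper_tail:
  assumes r: "\<And>v. v \<in> {1..n} \<Longrightarrow> arcs_prob n p (\<lambda>b. (v, v) \<in> (Collect b)\<^sup>+) \<le> r"
    and x: "1 \<le> x" and n: "1 \<le> n"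
  shows "measure_pmf.prob (random_digraph n p) {G. x < real (largest_scc_size G)} \<le> real n * r / x"
proof -
  define N where "N b = {u \<in> {1..n}. (u, u) \<in> (Collect b)\<^sup>+}" for b :: "nat \<times> nat \<Rightarrow> bool"
  have "measure_pmf.prob (random_digraph n p) {G. x < real (largest_scc_size G)}
      = arcs_prob n p (\<lambda>b. x < real (largest_scc_size \<lparr>pverts = {1..n}, parcs = Collect b\<rparr>))"
    by (simp add: random_digraph_eq vimage_def)
  also have "\<dots> \<le> arcs_prob n p (\<lambda>b. x < real (card (N b)))"
  proof (rule arcs_prob_mono)
    fix b assume b: "b \<in> set_pmf (arcs_pmf n p)"
      and "x < real (largest_scc_size \<lparr>pverts = {1..n}, parcs = Collect b\<rparr>)"
    with largest_scc_size_le[OF pair_digraph_arcs_pmf[OF b]] n x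
    show "x < real (card (N b))"
      by (auto simp: N_def max_def split: if_splits)
  qed
  finally have "x * measure_pmf.prob (random_digraph n p) {G. x < real (largest_scc_size G)}
      \<le> x * arcs_prob n p (\<lambda>b. x < real (card (N b)))"
    using x by (intro mult_left_mono) auto
  also have "\<dots> = measure_pmf.expectation (arcs_pmf n p) (\<lambda>b. x * indicator {b. x < real (card (N b))} b)"
    by simp
  also have "\<dots> \<le> measure_pmf.expectation (arcs_pmf n p) (\<lambda>b. real (card (N b)))"
    by (intro integral_mono integrable_measure_pmf_finite) (auto simp: indicator_def)
  also have "\<dots> = measure_pmf.expectation (arcs_pmf n p)
      (\<lambda>b. \<Sum>v\<in>{1..n}. indicator {b. (v, v) \<in> (Collect b)\<^sup>+} b)"
    by (intro Bochner_Integration.integral_cong refl) (auto simp: N_def indicator_def sum.If_cases Int_def)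
  also have "\<dots> = (\<Sum>v\<in>{1..n}. arcs_prob n p (\<lambda>b. (v, v) \<in> (Collect b)\<^sup>+))"
    by (subst Bochner_Integration.integral_sum) (auto intro: integrable_measure_pmf_finite)
  also have "\<dots> \<le> (\<Sum>v\<in>{1..n}. r)"
    by (intro sum_mono r)
  finally show ?thesis
    using x by (simp add: field_simps)
qed

text \<open>Taking \<open>h\<close> of order \<open>t\<close> balances the two terms of
  \<open>closed_walk_prob\<close>: each of at most \<open>2 * t\<close> cycle lengths contributes
  order \<open>1 / n\<close>, and the squared path probability is of order
  \<open>1 / t\<^sup>2\<close>. The constant 18 is 2 + 16 from these two terms.\<close>

lemma closed_walk_prob_critical:
  fixes lam t :: real
  assumes n: "real n = t ^ 3" and t: "2 * (1 + \<bar>lam\<bar>) \<le> t" and v: "v \<in> {1..n}"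
  defines "p \<equiv> (1 + lam / t) / real n"
  shows "arcs_prob n p (\<lambda>b. (v, v) \<in> (Collect b)\<^sup>+)
      \<le> 18 * exp (2 * (\<bar>lam\<bar> + 2 * (1 + \<bar>lam\<bar>)\<^sup>2)) / t\<^sup>2"
proof -
  \<comment> \<open>The summand \<open>\<bar>lam\<bar>\<close> comes from \<open>real n * p\<close>,
    the other from the quadratic term in the bound on \<open>- ln (1 - p)\<close>.\<close>
  define K where "K = \<bar>lam\<bar> + 2 * (1 + \<bar>lam\<bar>)\<^sup>2"
  define \<mu> where "\<mu> = 1 + K / t"
  define h where "h = nat \<lfloor>t\<rfloor>"
  have t2: "2 \<le> t"
    using t abs_ge_zero[of lam] by (simp add: algebra_simps)
  have K0: "K \<ge> 0"
    by (simp add: K_def)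
  have \<mu>1: "1 \<le> \<mu>"
    using K0 t2 by (simp add: \<mu>_def)
  have h: "real h \<le> t" "t / 2 \<le> real h" "1 \<le> h"
    unfolding h_def using t2 by linarith+
  have nt: "t \<le> real n"
    unfolding n using t2 power_increasing[of 1 3 t] by simp
  have lam: "\<bar>lam / t\<bar> \<le> 1 / 2" "\<bar>lam / t\<bar> \<le> \<bar>lam\<bar>"
    using t t2 mult_right_mono[of 1 t "\<bar>lam\<bar>"] by (simp_all add: field_simps)
  have np: "real n * p = 1 + lam / t"
    using nt t2 by (simp add: p_def)
  have p0: "0 < p"
    unfolding p_def using lam nt t2 by (intro divide_pos_pos) linarith+
  have p_half: "p \<le> 1 / 2"
  proof -
    have "(1 + lam / t) * 2 \<le> (1 + \<bar>lam\<bar>) * 2"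
      using abs_le_D1[OF lam(2)] by (intro mult_right_mono) auto
    also have "\<dots> \<le> real n"
      using nt t by simp
    finally have "(1 + lam / t) * 2 \<le> real n" .
    then show ?thesis
      using nt t2 by (simp add: p_def field_simps)
  qed
  have "- (real n * ln (1 - p)) = real n * (- ln (1 - p))"
    by simp
  also have "\<dots> \<le> real n * (p + 2 * p\<^sup>2)"
    using ln_one_minus_pos_lower_bound[of p] p0 p_half by (intro mult_left_mono) auto
  also have "\<dots> = 1 + lam / t + 2 * (1 + lam / t)\<^sup>2 / real n"
    using nt t2 by (simp add: np[symmetric] algebra_simps power2_eq_square)
  also have "\<dots> \<le> 1 + \<bar>lam\<bar> / t + 2 * (1 + \<bar>lam\<bar>)\<^sup>2 / t"
  proof (intro add_mono order_refl)
    show "lam / t \<le> \<bar>lam\<bar> / t"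
      using t2 by (intro divide_right_mono) auto
    have "(1 + lam / t)\<^sup>2 \<le> (1 + \<bar>lam\<bar>)\<^sup>2"
      using lam by (intro power_mono) linarith+
    then show "2 * (1 + lam / t)\<^sup>2 / real n \<le> 2 * (1 + \<bar>lam\<bar>)\<^sup>2 / t"
      using nt t2 by (intro frac_le) auto
  qed
  also have "\<dots> = \<mu>"
    by (simp add: \<mu>_def K_def add_divide_distrib)
  finally have \<mu>2: "- (real n * ln (1 - p)) \<le> \<mu>" .
  have np\<mu>: "real n * p \<le> \<mu>"
  proof -
    have "lam \<le> K"
      unfolding K_def using abs_ge_self[of lam] zero_le_power2[of "1 + \<bar>lam\<bar>"] by linarith
    then have "lam / t \<le> K / t"
      using t2 by (intro divide_right_mono) auto
    then show ?thesis by (simp add: np \<mu>_def)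
  qed
  have pow: "\<mu> ^ l \<le> exp (K * (real l / t))" for l
  proof -
    have "\<mu> ^ l \<le> exp (K / t) ^ l"
      using exp_ge_add_one_self[of "K / t"] \<mu>1 by (intro power_mono) (auto simp: \<mu>_def)
    then show ?thesis
      by (simp add: exp_of_nat_mult[symmetric] mult.commute)
  qed
  have pow_h: "\<mu> ^ h \<le> exp K"
    using h t2 K0 mult_left_mono[of "real h / t" 1 K] by (intro order_trans[OF pow]) auto
  have sum_le: "(\<Sum>l=2..2*h. real n ^ (l - 1) * p ^ l) \<le> 2 * exp (2 * K) / t\<^sup>2"
  proof -
    have "(\<Sum>l=2..2*h. real n ^ (l - 1) * p ^ l) \<le> (\<Sum>l=2..2*h. exp (2 * K) / real n)"
    proof (rule sum_mono)
      fix l assume l: "l \<in> {2..2*h}"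
      then have "real n ^ (l - 1) * p ^ l = (real n * p) ^ l / real n"
        using nt t2 by (cases l) (auto simp: power_mult_distrib)
      also have "(real n * p) ^ l \<le> \<mu> ^ l"
        using p0 np\<mu> by (intro power_mono) auto
      also have "\<mu> ^ l \<le> exp (K * (real l / t))"
        by (rule pow)
      also have "\<dots> \<le> exp (2 * K)"
      proof -
        have "real l / t \<le> 2"
          using l h(1) t2 by (simp add: field_simps)
        then show ?thesis
          using K0 mult_left_mono[of "real l / t" 2 K] by simp
      qed
      finally show "real n ^ (l - 1) * p ^ l \<le> exp (2 * K) / real n"
        using nt t2 by (simp add: divide_right_mono)
    qed
    also have "\<dots> \<le> (2 * t) * (exp (2 * K) / real n)"
    proof -
      have "real (card {2..2*h}) \<le> 2 * t"
        using h(1) by simp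
      then show ?thesis
        unfolding sum_constant by (rule mult_right_mono) simp
    qed
    also have "\<dots> = 2 * exp (2 * K) / t\<^sup>2"
      using t2 by (simp add: n power3_eq_cube power2_eq_square)
    finally show ?thesis .
  qed
  have "2 * \<mu> ^ h / real h \<le> 2 * exp K / (t / 2)"
    using pow_h h t2 by (intro frac_le) auto
  then have "(2 * \<mu> ^ h / real h)\<^sup>2 \<le> (2 * exp K / (t / 2))\<^sup>2"
    using \<mu>1 by (intro power_mono) auto
  also have "\<dots> = 16 * exp (2 * K) / t\<^sup>2"
    by (simp add: power_divide power_mult_distrib exp_double)
  finally have sq: "(2 * \<mu> ^ h / real h)\<^sup>2 \<le> 16 * exp (2 * K) / t\<^sup>2" .
  have "arcs_prob n p (\<lambda>b. (v, v) \<in> (Collect b)\<^sup>+)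
      \<le> (\<Sum>l=2..2*h. real n ^ (l - 1) * p ^ l) + (2 * \<mu> ^ h / real h)\<^sup>2"
    by (rule closed_walk_prob) (use p0 p_half \<mu>1 \<mu>2 h v in auto)
  also have "\<dots> \<le> 18 * exp (2 * K) / t\<^sup>2"
    using sum_le sq by (simp add: add_divide_distrib[symmetric] field_simps)
  finally show ?thesis
    by (simp add: K_def)
qed

section \<open>Second moment of the number of long cycles\<close>

fun walk_weight :: "('a \<times> 'a \<Rightarrow> real) \<Rightarrow> 'a \<Rightarrow> 'a list \<Rightarrow> real" where
  "walk_weight w x [] = 1"
| "walk_weight w x (y # ys) = w (x, y) * walk_weight w y ys"

definition total_weight :: "('a \<times> 'a \<Rightarrow> real) \<Rightarrow> 'a set \<Rightarrow> nat \<Rightarrow> 'a \<Rightarrow> real" where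
  "total_weight w V l x = (\<Sum>ys | set ys \<subseteq> V \<and> length ys = l. walk_weight w x ys)"

lemma total_weight_0 [simp]: "total_weight w V 0 x = 1"
proof -
  have "{ys. set ys \<subseteq> V \<and> length ys = 0} = {[]}" by auto
  then show ?thesis by (simp add: total_weight_def)
qed

lemma total_weight_Suc:
  "total_weight w V (Suc l) x = (\<Sum>y\<in>V. w (x, y) * total_weight w V l y)"
proof -
  have "total_weight w V (Suc l) x =
      (\<Sum>(ys, y)\<in>{ys. set ys \<subseteq> V \<and> length ys = l} \<times> V. w (x, y) * walk_weight w y ys)"
    unfolding total_weight_def lists_length_Suc_eq
    by (subst sum.reindex) (auto simp: inj_on_def intro!: sum.cong)
  then show ?thesis
    unfolding sum.cartesian_product[symmetric] total_weight_def
    by (subst (asm) sum.swap) (simp add: sum_distrib_left)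
qed

lemma total_weight_nonneg: "(\<And>e. 0 \<le> w e) \<Longrightarrow> 0 \<le> total_weight w V l x"
proof (induction l arbitrary: x)
  case (Suc l)
  then show ?case
    unfolding total_weight_Suc by (intro sum_nonneg mult_nonneg_nonneg) auto
qed simp

text \<open>Arcs of the fixed cycle cost nothing.  A walk can only gain weight by leaving the cycle, which
  gives linear growth \<open>1 + 2 * \<mu> ^ m * l\<close> as long as returns to the cycle are rare.\<close>

lemma total_weight_le:
  fixes w :: "'a \<times> 'a \<Rightarrow> real"
  assumes V: "finite V" and X: "X \<subseteq> V" "C \<subseteq> X \<times> X"
    and single: "\<And>x y z. (x, y) \<in> C \<Longrightarrow> (x, z) \<in> C \<Longrightarrow> y = z"
    and w: "\<And>e. w e = (if e \<in> C then 1 else p)" and p: "0 \<le> p"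
    and \<mu>: "1 \<le> \<mu>" "real (card V) * p \<le> \<mu>"
    and A: "A = 1 + 2 * \<mu> ^ m * real m" and small: "real m * (p * real (card X) * A) \<le> 1"
    and l: "l \<le> m" and x: "x \<in> X"
  shows "total_weight w V l x \<le> A"
proof -
  \<comment> \<open>\<open>\<kappa>\<close> bounds the weight gained by one return to
    \<open>X\<close>: an arc of weight \<open>p\<close> to one of its vertices, then at most
    \<open>A\<close>. By \<open>small\<close>, \<open>m\<close> returns add at most 1.\<close>
  define \<kappa> where "\<kappa> = p * real (card X) * A"
  have \<mu>pow: "1 \<le> \<mu> ^ i" for i
    using \<mu> by simp
  have A0: "0 \<le> A"
    unfolding A using \<mu> by simp
  have \<kappa>0: "0 \<le> \<kappa>"
    using p A0 by (simp add: \<kappa>_def)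
  have [simp]: "finite X"
    using X V finite_subset by blast
  have w0: "0 \<le> w e" for e
    using w p by simp
  \<comment> \<open>Starting points on and off \<open>X\<close> are treated in one induction, since
    a step may pass from either kind to the other.\<close>
  have "(\<forall>x\<in>X. total_weight w V l x \<le> 1 + 2 * \<mu> ^ m * real l) \<and>
      (\<forall>x\<in>V. x \<notin> X \<longrightarrow> total_weight w V l x \<le> \<mu> ^ l * (1 + real l * \<kappa>))"
    using l
  proof (induction l)
    case (Suc l)
    let ?a = "1 + 2 * \<mu> ^ m * real l" and ?b = "\<mu> ^ l * (1 + real l * \<kappa>)"
    let ?c = "\<mu> ^ Suc l * (1 + real (Suc l) * \<kappa>)"
    have a: "total_weight w V l y \<le> ?a" if "y \<in> X" for y
      using Suc that by simp
    have b: "total_weight w V l y \<le> ?b" if "y \<in> V - X" for y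
      using Suc that by simp
    have aA: "?a \<le> A"
      unfolding A using Suc.prems \<mu> by (intro add_left_mono mult_left_mono) auto
    have b0: "?b \<ge> 0"
      using \<mu> \<kappa>0 by simp
    have jump: "p * (\<Sum>y\<in>V. total_weight w V l y) \<le> ?c"
    proof -
      have "(\<Sum>y\<in>V. total_weight w V l y) =
          (\<Sum>y\<in>V - X. total_weight w V l y) + (\<Sum>y\<in>X. total_weight w V l y)"
        using V X by (intro sum.subset_diff)
      also have "\<dots> \<le> (\<Sum>y\<in>V - X. ?b) + (\<Sum>y\<in>X. A)"
        using a b aA by (intro add_mono sum_mono) force+
      also have "\<dots> \<le> real (card V) * ?b + real (card X) * A"
        using b0 card_mono[OF V, of "V - X"] by (auto intro!: mult_right_mono)
      finally have "p * (\<Sum>y\<in>V. total_weight w V l y) \<le> p * (real (card V) * ?b + real (card X) * A)"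
        using p by (rule mult_left_mono)
      also have "\<dots> = real (card V) * p * ?b + \<kappa>"
        by (simp add: \<kappa>_def algebra_simps)
      also have "\<dots> \<le> \<mu> * ?b + \<mu> ^ Suc l * \<kappa>"
        using mult_right_mono[OF \<mu>(2) b0] mult_right_mono[OF \<mu>pow[of "Suc l"] \<kappa>0] by simp
      also have "\<dots> = ?c"
        by (simp add: algebra_simps)
      finally show ?thesis .
    qed
    have c: "?c \<le> 2 * \<mu> ^ m"
    proof -
      have "real (Suc l) * \<kappa> \<le> real m * \<kappa>"
        using Suc.prems \<kappa>0 by (intro mult_right_mono) auto
      then have "1 + real (Suc l) * \<kappa> \<le> 2"
        using small unfolding \<kappa>_def by linarith
      moreover have "\<mu> ^ Suc l \<le> \<mu> ^ m"
        using Suc.prems \<mu> by (intro power_increasing) auto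
      ultimately have "?c \<le> \<mu> ^ m * 2"
        using \<mu> \<kappa>0 by (intro mult_mono) auto
      then show ?thesis by simp
    qed
    \<comment> \<open>An arc of \<open>C\<close> is counted with weight 1 and once more with weight
      \<open>p\<close>; the excess is harmless and lets the second sum run over all of
      \<open>V\<close>.\<close>
    have split: "total_weight w V (Suc l) x \<le>
        (\<Sum>y\<in>{y \<in> V. (x, y) \<in> C}. total_weight w V l y) + p * (\<Sum>y\<in>V. total_weight w V l y)" for x
    proof -
      have "total_weight w V (Suc l) x \<le> (\<Sum>y\<in>V. (if (x, y) \<in> C then total_weight w V l y else 0) +
          p * total_weight w V l y)"
        unfolding total_weight_Suc
        using total_weight_nonneg[of w V l] w0 w p by (intro sum_mono) auto
      then show ?thesis
        using V by (simp add: sum.distrib sum_distrib_left sum.inter_filter)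
    qed
    show ?case
    proof (intro conjI ballI impI)
      fix x assume "x \<in> V" "x \<notin> X"
      then have none: "{y \<in> V. (x, y) \<in> C} = {}"
        using X by auto
      show "total_weight w V (Suc l) x \<le> ?c"
        using split[of x] jump unfolding none by simp
    next
      fix x assume "x \<in> X"
      have "(\<Sum>y\<in>{y \<in> V. (x, y) \<in> C}. total_weight w V l y) \<le> ?a"
      proof (cases "\<exists>y. (x, y) \<in> C")
        case True
        then obtain y where y: "(x, y) \<in> C" by blast
        then have "{y \<in> V. (x, y) \<in> C} = {y}"
          using X single by auto
        then show ?thesis
          using a[of y] y X by auto
      next
        case False
        then show ?thesis
          using \<mu> by simp
      qed
      then have "total_weight w V (Suc l) x \<le> ?a + 2 * \<mu> ^ m"
        using split[of x] jump c by linarith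
      then show "total_weight w V (Suc l) x \<le> 1 + 2 * \<mu> ^ m * real (Suc l)"
        by (simp add: algebra_simps)
    qed
  qed simp
  then have "total_weight w V l x \<le> 1 + 2 * \<mu> ^ m * real l"
    using x by blast
  also have "\<dots> \<le> A"
    unfolding A using l \<mu> by (intro add_left_mono mult_left_mono) auto
  finally show ?thesis .
qed

section \<open>Rotations of cycles and overlapping pairs of cycles\<close>

lemma cyc_rotate [simp]: "cyc (rotate i xs) = cyc xs"
proof (induction i)
  case (Suc i)
  have "zip (rotate1 xs) (rotate1 ys) = rotate1 (zip xs ys)" if "length xs = length ys" for xs ys :: "'a list"
    using that by (cases xs; cases ys) auto
  then have "cyc (rotate1 xs) = cyc xs" for xs :: "'a list"
    by (simp add: cyc_def)
  with Suc show ?case by simp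
qed simp

lemma cyc_single_valued:
  assumes "distinct xs" "(x, y) \<in> cyc xs" "(x, z) \<in> cyc xs"
  shows "y = z"
  using assms by (auto simp: cyc_conv_nth nth_eq_iff_index_eq)

lemma cyc_subset_Times: "cyc xs \<subseteq> set xs \<times> set xs"
  by (auto simp: cyc_def dest: set_zip_leftD set_zip_rightD)

lemma prod_cyc_Cons:
  assumes "distinct (r # zs)"
  shows "(\<Prod>e\<in>cyc (r # zs). w e) = walk_weight w r zs * w (last (r # zs), r)"
proof -
  \<comment> \<open>The closing vertex is a separate variable \<open>s\<close> because the induction
    moves the starting vertex \<open>r\<close>.\<close>
  have *: "prod_list (map w (zip (r # zs) (zs @ [s]))) = walk_weight w r zs * w (last (r # zs), s)" for s
    by (induction zs arbitrary: r) auto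
  have "(\<Prod>e\<in>cyc (r # zs). w e) = prod_list (map w (zip (r # zs) (zs @ [r])))"
    unfolding cyc_def using assms
    by (subst prod.distinct_set_conv_list) (auto intro!: distinct_zipI1)
  then show ?thesis
    using * by simp
qed

text \<open>Each list is charged to one of its rotations satisfying \<open>Q\<close>. Every rotation
  permutes \<open>F\<close> and preserves \<open>g\<close>, so each of the \<open>L\<close> shifts
  accounts for one copy of the restricted sum.\<close>

lemma sum_le_rotations:
  fixes g :: "'a list \<Rightarrow> real"
  assumes F: "finite F" "\<And>ys. ys \<in> F \<Longrightarrow> rotate1 ys \<in> F"
    and g: "\<And>ys. g (rotate1 ys) = g ys" "\<And>ys. 0 \<le> g ys"
    and Q: "\<And>ys. ys \<in> F \<Longrightarrow> \<exists>i<L. Q (rotate i ys)"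
  shows "sum g F \<le> real L * sum g {ys \<in> F. Q ys}"
proof -
  define h where "h ys = (if Q ys then g ys else 0)" for ys
  have rot_g: "g (rotate i ys) = g ys" for i ys
    by (induction i) (auto simp: g)
  have bij: "bij_betw (rotate i) F F" for i
  proof -
    have "rotate i ` F \<subseteq> F"
    proof (induction i)
      case (Suc i)
      then show ?case using F(2) by auto
    qed auto
    moreover have "inj_on (rotate i) F"
      by (rule inj_on_subset[of _ UNIV]) (simp_all add: rotate_def inj_fn inj_rotate1)
    ultimately show ?thesis
      using F(1) by (simp add: bij_betw_def endo_inj_surj)
  qed
  have "sum g F \<le> (\<Sum>ys\<in>F. \<Sum>i<L. h (rotate i ys))"
  proof (rule sum_mono)
    fix ys assume "ys \<in> F"
    then obtain i where "i < L" "Q (rotate i ys)"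
      using Q by blast
    then have "g ys = h (rotate i ys)" by (simp add: h_def rot_g)
    also have "\<dots> \<le> (\<Sum>i<L. h (rotate i ys))"
      using \<open>i < L\<close> g(2) by (intro member_le_sum) (auto simp: h_def)
    finally show "g ys \<le> (\<Sum>i<L. h (rotate i ys))" .
  qed
  also have "\<dots> = (\<Sum>i<L. \<Sum>ys\<in>F. h (rotate i ys))"
    by (rule sum.swap)
  also have "\<dots> = (\<Sum>i<L. sum h F)"
    by (intro sum.cong refl sum.reindex_bij_betw bij)
  also have "\<dots> = real L * sum g {ys \<in> F. Q ys}"
    using F(1) by (simp add: h_def sum.inter_filter)
  finally show ?thesis .
qed

text \<open>Either some arc of the cycle \<open>ys\<close> enters \<open>set xs\<close> without belonging to \<open>xs\<close>, and the rotation
  starts at its head, or \<open>ys\<close> follows \<open>xs\<close> all the way round.\<close>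

lemma rotation_entering:
  assumes xs: "distinct xs" and ys: "distinct ys" and meet: "set ys \<inter> set xs \<noteq> {}"
  shows "\<exists>i<length ys. rotate i ys = xs \<or>
    (hd (rotate i ys) \<in> set xs \<and> (last (rotate i ys), hd (rotate i ys)) \<notin> cyc xs)"
proof (rule ccontr)
  let ?L = "length ys" and ?k = "length xs"
  assume neg: "\<not> ?thesis"
  have L: "0 < ?L"
    using meet by auto
  \<comment> \<open>Modulo \<open>?L\<close>, adding \<open>?L - 1\<close> yields the preceding
    index without a subtraction at 0.\<close>
  have last: "last (rotate i ys) = ys ! ((i + (?L - 1)) mod ?L)" and hd: "hd (rotate i ys) = ys ! (i mod ?L)" for i
    using L by (auto simp: last_conv_nth nth_rotate hd_rotate_conv_nth)
  \<comment> \<open>By \<open>neg\<close>, every arc of \<open>ys\<close> that ends in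
    \<open>set xs\<close> lies in \<open>cyc xs\<close>.\<close>
  have enter: "(ys ! i, ys ! (Suc i mod ?L)) \<in> cyc xs" if "i < ?L" "ys ! (Suc i mod ?L) \<in> set xs" for i
  proof -
    have "Suc i mod ?L < ?L" using L by simp
    moreover have "(Suc i mod ?L + (?L - 1)) mod ?L = i"
    proof (cases "Suc i = ?L")
      case False
      then have "Suc i mod ?L + (?L - 1) = i + ?L"
        using that(1) by simp
      then show ?thesis
        using that(1) by simp
    qed auto
    moreover have "hd (rotate (Suc i mod ?L) ys) = ys ! (Suc i mod ?L)"
      using L by (simp add: hd)
    ultimately show ?thesis
      using neg that(2) last[of "Suc i mod ?L"] by auto
  qed
  obtain i0 where i0: "i0 < ?L" "ys ! i0 \<in> set xs"
    using meet by (metis disjoint_iff in_set_conv_nth)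
  \<comment> \<open>Hence predecessors of vertices in \<open>set xs\<close> stay there, and walking
    backwards covers all of \<open>ys\<close>.\<close>
  have pred_mem: "ys ! ((i0 + (?L - 1) * d) mod ?L) \<in> set xs" for d
  proof (induction d)
    case (Suc d)
    define i where "i = (i0 + (?L - 1) * Suc d) mod ?L"
    have "Suc i mod ?L = Suc (i0 + (?L - 1) * Suc d) mod ?L"
      unfolding i_def by (simp only: mod_Suc_eq)
    also have "Suc (i0 + (?L - 1) * Suc d) = (i0 + (?L - 1) * d) + ?L"
      using L unfolding mult_Suc_right by linarith
    finally have "Suc i mod ?L = (i0 + (?L - 1) * d) mod ?L" by simp
    moreover have "i < ?L"
      using L by (simp add: i_def)
    ultimately have "(ys ! i, ys ! (Suc i mod ?L)) \<in> cyc xs"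
      using Suc by (intro enter) simp_all
    then show ?case
      unfolding i_def using cyc_subset_Times by blast
  qed (use i0 in simp)
  have mem: "ys ! i \<in> set xs" if "i < ?L" for i
  proof -
    define d where "d = i0 + ?L - i"
    have "(?L - 1) * d + d = ?L * d"
      using L by (cases ?L) auto
    then have "i0 + (?L - 1) * d + ?L = i + ?L * d"
      using that by (simp add: d_def)
    then have "(i0 + (?L - 1) * d + ?L) mod ?L = i"
      using that by simp
    then show ?thesis
      using pred_mem[of d] by simp
  qed
  have arc: "(ys ! i, ys ! (Suc i mod ?L)) \<in> cyc xs" if "i < ?L" for i
    using that L by (intro enter mem) auto
  obtain j where j: "j < ?k" "ys ! 0 = xs ! j"
    using mem[OF L] by (auto simp: in_set_conv_nth)
  have mod_k: "(j + i) mod ?k < ?k" for i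
    using j(1) by (intro mod_less_divisor) linarith
  \<comment> \<open>A vertex has only one successor in \<open>cyc xs\<close>, so \<open>ys\<close>
    runs along \<open>xs\<close> with shift \<open>j\<close>.\<close>
  have follow: "ys ! (i mod ?L) = xs ! ((j + i) mod ?k)" for i
  proof (induction i)
    case (Suc i)
    have "(ys ! (i mod ?L), ys ! (Suc i mod ?L)) \<in> cyc xs"
      using arc[of "i mod ?L"] L by (simp add: mod_Suc_eq)
    moreover have "(xs ! ((j + i) mod ?k), xs ! (Suc ((j + i) mod ?k) mod ?k)) \<in> cyc xs"
      unfolding cyc_conv_nth using mod_k by blast
    ultimately show ?case
      using Suc xs by (auto simp: mod_Suc_eq dest: cyc_single_valued)
  qed (use j in simp)
  have "xs ! ((j + ?L) mod ?k) = xs ! j"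
    using follow[of ?L] j by simp
  then have "(j + ?L) mod ?k = j"
    using nth_eq_iff_index_eq[OF xs mod_k j(1)] by simp
  then have "?k dvd ?L"
    using j(1) by (metis add_diff_cancel_left' mod_eq_dvd_iff_nat le_add1 mod_less)
  moreover have "?L \<le> ?k"
  proof -
    have "set ys \<subseteq> set xs"
      using mem by (auto simp: in_set_conv_nth)
    then have "card (set ys) \<le> card (set xs)"
      by (intro card_mono) auto
    then show ?thesis
      using xs ys by (simp add: distinct_card)
  qed
  ultimately have kL: "?L = ?k"
    using L by (simp add: dvd_imp_le le_antisym)
  have "ys = rotate j xs"
  proof (rule nth_equalityI)
    fix i assume "i < ?L"
    then show "ys ! i = rotate j xs ! i"
      using follow[of i] by (simp add: nth_rotate kL)
  qed (simp add: kL)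
  then have "rotate (?k - j) ys = xs"
    using j(1) by (simp add: rotate_rotate)
  \<comment> \<open>For \<open>j = 0\<close> the shift equals \<open>?L\<close>, so it is reduced to
    satisfy the bound \<open>i < length ys\<close>.\<close>
  then have "rotate ((?k - j) mod ?L) ys = xs"
    by (metis rotate_conv_mod)
  then show False
    using neg L by auto
qed

text \<open>A cycle is listed once for each choice of its first vertex, hence the weights
  \<open>1 / length xs\<close> below.\<close>

definition cycles :: "nat \<Rightarrow> nat \<Rightarrow> nat \<Rightarrow> nat list set" where
  "cycles n a m = {xs. set xs \<subseteq> {1..n} \<and> distinct xs \<and> a \<le> length xs \<and> length xs \<le> m}"

lemma finite_cycles [simp]: "finite (cycles n a m)"
  by (rule finite_subset[OF _ finite_lists_length_le[of "{1..n}" m]]) (auto simp: cycles_def)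

lemma finite_cyc [simp]: "finite (cyc xs)"
  by (simp add: cyc_def)

text \<open>Rotate \<open>ys\<close> so that it is \<open>xs\<close> or its closing arc ends in
  \<open>set xs\<close> without being an arc of \<open>xs\<close>. In the latter case the closing
  arc costs \<open>p\<close>, and the rest is a walk starting on \<open>xs\<close>, of total weight
  at most \<open>A\<close>. At most \<open>m\<close> starting points and \<open>m\<close> lengths
  give at most 1 by \<open>small\<close>; the number of rotations cancels
  \<open>1 / length ys\<close>. The other unit is the case \<open>xs\<close>.\<close>

lemma cycle_overlap_sum:
  assumes a: "1 \<le> a" and p: "0 \<le> p" and \<mu>: "1 \<le> \<mu>" "real n * p \<le> \<mu>"
    and small: "p * real m * real m * (1 + 2 * \<mu> ^ m * real m) \<le> 1"
    and xs: "xs \<in> cycles n a m"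
  shows "(\<Sum>ys | ys \<in> cycles n a m \<and> set ys \<inter> set xs \<noteq> {}. p ^ card (cyc ys - cyc xs) / real (length ys)) \<le> 2"
proof -
  define A where "A = 1 + 2 * \<mu> ^ m * real m"
  define w where "w e = (if e \<in> cyc xs then 1 else p)" for e
  define g where "g ys = (\<Prod>e\<in>cyc ys. w e)" for ys
  define Q where "Q ys \<longleftrightarrow> ys = xs \<or> (hd ys \<in> set xs \<and> (last ys, hd ys) \<notin> cyc xs)" for ys
  define Ov where "Ov = {ys. ys \<in> cycles n a m \<and> set ys \<inter> set xs \<noteq> {}}"
  define F where "F L = {ys \<in> Ov. length ys = L}" for L
  let ?k = "real (card (set xs))"
  have A0: "0 \<le> A"
    using \<mu> by (simp add: A_def)
  have k: "?k \<le> real m"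
    using xs by (simp add: cycles_def distinct_card)
  have w0: "0 \<le> w e" for e
    using p by (simp add: w_def)
  have g0: "0 \<le> g ys" for ys
    by (simp add: g_def w0 prod_nonneg)
  have g_eq: "g ys = p ^ card (cyc ys - cyc xs)" for ys
    by (simp add: g_def w_def prod.If_cases Diff_eq)
  have finO: "finite Ov"
    by (rule finite_subset[of _ "cycles n a m"]) (auto simp: Ov_def)
  have pkA: "?k * (p * A) \<le> real m * p * A"
    using k p A0 by (simp add: mult_right_mono mult.assoc)
  have kpA: "real m * (p * ?k * A) \<le> 1"
  proof -
    have "real m * (p * ?k * A) \<le> real m * (p * real m * A)"
      using k p A0 by (intro mult_left_mono mult_right_mono) auto
    also have "\<dots> \<le> 1"
      using small by (simp add: A_def algebra_simps)
    finally show ?thesis .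
  qed
  have tw: "total_weight w {1..n} l r \<le> A" if "r \<in> set xs" "l \<le> m" for l r
  proof (rule total_weight_le[where X = "set xs" and C = "cyc xs" and p = p and \<mu> = \<mu> and m = m])
    show "\<And>x y z. (x, y) \<in> cyc xs \<Longrightarrow> (x, z) \<in> cyc xs \<Longrightarrow> y = z"
      using xs cyc_single_valued by (auto simp: cycles_def)
  qed (use xs p \<mu> that kpA cyc_subset_Times in \<open>auto simp: cycles_def w_def A_def\<close>)
  have Q_sum: "sum g {ys \<in> F L. Q ys} \<le> (if L = length xs then 1 else 0) + real m * p * A"
    if L: "L \<in> {a..m}" for L
  proof -
    define T where "T = {ys \<in> F L. hd ys \<in> set xs \<and> (last ys, hd ys) \<notin> cyc xs}"
    define D where "D = (if L = length xs then {xs} else {})"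
    define g' where "g' z = walk_weight w (fst z) (snd z) * p" for z
    define Z where "Z = {zs. set zs \<subseteq> {1..n} \<and> length zs = L - 1}"
    have [simp]: "finite T" "finite D"
      using finO by (auto simp: T_def D_def F_def)
    have "walk_weight w x zs \<ge> 0" for x zs
      by (induction zs arbitrary: x) (auto simp: w0)
    then have g'0: "g' z \<ge> 0" for z
      using p by (simp add: g'_def)
    have T: "ys \<noteq> []" "distinct ys" "length ys = L" "set ys \<subseteq> {1..n}" if "ys \<in> T" for ys
      using that L a by (auto simp: T_def F_def Ov_def cycles_def)
    have "sum g {ys \<in> F L. Q ys} \<le> sum g (D \<union> T)"
    proof (rule sum_mono2)
      show "finite (D \<union> T)" by simp
    qed (use g0 in \<open>auto simp: D_def T_def F_def Q_def\<close>)
    also have "\<dots> \<le> sum g D + sum g T"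
      using sum.union_inter[of D T g] sum_nonneg[of "D \<inter> T" g] g0 by simp
    also have "sum g D = (if L = length xs then 1 else 0)"
      by (simp add: D_def g_eq)
    also have "sum g T = (\<Sum>ys\<in>T. g' (hd ys, tl ys))"
    proof (rule sum.cong[OF refl])
      fix ys assume ys: "ys \<in> T"
      then obtain r zs where rz: "ys = r # zs"
        using T(1) by (cases ys) auto
      have "g ys = walk_weight w r zs * w (last (r # zs), r)"
        unfolding g_def rz using T(2)[OF ys] rz by (intro prod_cyc_Cons) simp
      then show "g ys = g' (hd ys, tl ys)"
        using ys by (auto simp: T_def g'_def rz w_def)
    qed
    also have "\<dots> = sum g' ((\<lambda>ys. (hd ys, tl ys)) ` T)"
    proof -
      have "inj_on (\<lambda>ys. (hd ys, tl ys)) T"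
        by (rule inj_onI) (metis T(1) list.collapse prod.inject)
      then show ?thesis
        by (simp add: sum.reindex)
    qed
    \<comment> \<open>Distinctness is dropped here, so that the sum runs over all walks starting in
      \<open>set xs\<close>.\<close>
    also have "\<dots> \<le> sum g' (set xs \<times> Z)"
    proof (rule sum_mono2)
      show "finite (set xs \<times> Z)"
        unfolding Z_def by (intro finite_cartesian_product finite_lists_length_eq) auto
      show "(\<lambda>ys. (hd ys, tl ys)) ` T \<subseteq> set xs \<times> Z"
      proof (rule image_subsetI)
        fix ys assume ys: "ys \<in> T"
        then have "set (tl ys) \<subseteq> {1..n}"
          using T(1)[OF ys] T(4)[OF ys] by (cases ys) auto
        then show "(hd ys, tl ys) \<in> set xs \<times> Z"
          using ys T(3)[OF ys] by (auto simp: Z_def T_def)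
      qed
    qed (use g'0 in auto)
    also have "\<dots> = (\<Sum>r\<in>set xs. total_weight w {1..n} (L - 1) r * p)"
      by (simp add: g'_def total_weight_def Z_def sum_distrib_right sum.cartesian_product' )
    also have "\<dots> \<le> (\<Sum>r\<in>set xs. A * p)"
      using p L by (intro sum_mono mult_right_mono tw) auto
    also have "\<dots> \<le> real m * p * A"
      using pkA by (simp add: mult.commute)
    finally show ?thesis by simp
  qed
  have "(\<Sum>ys\<in>Ov. g ys / real (length ys)) = (\<Sum>L\<in>{a..m}. \<Sum>ys\<in>F L. g ys / real (length ys))"
    unfolding F_def by (intro sum.group[symmetric] finO) (auto simp: Ov_def cycles_def)
  also have "\<dots> \<le> (\<Sum>L\<in>{a..m}. (if L = length xs then 1 else 0) + real m * p * A)"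
  proof (rule sum_mono)
    fix L assume L: "L \<in> {a..m}"
    have "sum g (F L) \<le> real L * sum g {ys \<in> F L. Q ys}"
    proof (rule sum_le_rotations)
      show "rotate1 ys \<in> F L" if "ys \<in> F L" for ys
        using that by (auto simp: F_def Ov_def cycles_def)
      show "g (rotate1 ys) = g ys" for ys
        using cyc_rotate[of 1 ys] by (simp add: g_def)
      show "\<exists>i<L. Q (rotate i ys)" if "ys \<in> F L" for ys
        unfolding Q_def using rotation_entering[of xs ys] that xs by (auto simp: F_def Ov_def cycles_def)
    qed (use g0 finO in \<open>auto simp: F_def\<close>)
    then have "sum g (F L) / real L \<le> sum g {ys \<in> F L. Q ys}"
      using L a by (simp add: field_simps)
    also have "\<dots> \<le> (if L = length xs then 1 else 0) + real m * p * A"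
      using L by (rule Q_sum)
    finally show "(\<Sum>ys\<in>F L. g ys / real (length ys)) \<le> (if L = length xs then 1 else 0) + real m * p * A"
      by (simp add: F_def sum_divide_distrib)
  qed
  also have "\<dots> = 1 + real (card {a..m}) * (real m * p * A)"
    using xs by (simp add: sum.distrib cycles_def)
  also have "\<dots> \<le> 1 + real m * (real m * p * A)"
    using a p A0 by (intro add_left_mono mult_right_mono mult_nonneg_nonneg) auto
  also have "\<dots> \<le> 2"
    using small by (simp add: A_def algebra_simps)
  finally show ?thesis
    by (simp add: Ov_def g_eq)
qed

text \<open>Chebyshev's inequality for the weighted count \<open>Z\<close> with mean
  \<open>s\<close>: vertex-disjoint cycles are independent, and intersecting pairs add at most
  \<open>2 * s\<close> to the variance.\<close>

lemma no_cycle_prob: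
  assumes a: "2 \<le> a" and p: "0 \<le> p" "p \<le> 1" and \<mu>: "1 \<le> \<mu>" "real n * p \<le> \<mu>"
    and small: "p * real m * real m * (1 + 2 * \<mu> ^ m * real m) \<le> 1"
  defines "s \<equiv> (\<Sum>xs\<in>cycles n a m. p ^ length xs / real (length xs))"
  assumes s: "0 < s"
  shows "arcs_prob n p (\<lambda>b. \<forall>xs\<in>cycles n a m. \<not> cyc xs \<subseteq> Collect b) \<le> 2 / s"
proof -
  let ?C = "cycles n a m" and ?M = "measure_pmf (arcs_pmf n p)"
  define I where "I xs b = (indicator {b. cyc xs \<subseteq> Collect b} b :: real)"
    for xs :: "nat list" and b
  define Z where "Z b = (\<Sum>xs\<in>?C. I xs b / real (length xs))" for b
  have int [simp]: "integrable ?M f" for f :: "(nat \<times> nat \<Rightarrow> bool) \<Rightarrow> real"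
    by (rule integrable_measure_pmf_finite) simp
  have slots: "cyc xs \<subseteq> arc_slots n" "card (cyc xs) = length xs" if "xs \<in> ?C" for xs
    using that a by (simp_all add: cycles_def cyc_subset_arc_slots card_cyc)
  have EI: "(\<integral>b. I xs b \<partial>?M) = p ^ length xs" if "xs \<in> ?C" for xs
    using arcs_prob_all_present[OF slots(1)[OF that] p] slots(2)[OF that] by (simp add: I_def)
  \<comment> \<open>Given \<open>xs\<close>, only the arcs of \<open>ys\<close> outside
    \<open>cyc xs\<close> still have to be present.\<close>
  have EII: "(\<integral>b. I xs b * I ys b \<partial>?M) = p ^ length xs * p ^ card (cyc ys - cyc xs)"
    if "xs \<in> ?C" "ys \<in> ?C" for xs ys
  proof -
    have "(\<integral>b. I xs b * I ys b \<partial>?M) = arcs_prob n p (\<lambda>b. cyc xs \<union> cyc ys \<subseteq> Collect b)"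
      by (simp add: I_def indicator_inter_arith[symmetric] Int_def)
    also have "\<dots> = p ^ card (cyc xs \<union> cyc ys)"
      using slots that p by (intro arcs_prob_all_present) auto
    also have "cyc xs \<union> cyc ys = cyc xs \<union> (cyc ys - cyc xs)" by auto
    also have "card \<dots> = length xs + card (cyc ys - cyc xs)"
      using slots(2)[OF that(1)] by (subst card_Un_disjoint) auto
    finally show ?thesis by (simp add: power_add)
  qed
  have EZ: "(\<integral>b. Z b \<partial>?M) = s"
    unfolding Z_def s_def by (subst Bochner_Integration.integral_sum) (auto simp: EI)
  have EZ2: "(\<integral>b. (Z b)\<^sup>2 \<partial>?M) \<le> s * (s + 2)"
  proof -
    have "(\<integral>b. (Z b)\<^sup>2 \<partial>?M) =
        (\<integral>b. (\<Sum>xs\<in>?C. \<Sum>ys\<in>?C. I xs b * I ys b / (real (length xs) * real (length ys))) \<partial>?M)"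
      by (simp add: Z_def power2_eq_square sum_product)
    also have "\<dots> = (\<Sum>xs\<in>?C. \<Sum>ys\<in>?C.
        p ^ length xs * p ^ card (cyc ys - cyc xs) / (real (length xs) * real (length ys)))"
      by (simp add: Bochner_Integration.integral_sum EII)
    also have "\<dots> = (\<Sum>xs\<in>?C. p ^ length xs / real (length xs) *
        (\<Sum>ys\<in>?C. p ^ card (cyc ys - cyc xs) / real (length ys)))"
      by (simp add: sum_distrib_left)
    also have "\<dots> \<le> (\<Sum>xs\<in>?C. p ^ length xs / real (length xs) * (s + 2))"
    proof (intro sum_mono mult_left_mono)
      fix xs assume xs: "xs \<in> ?C"
      let ?Ov = "{ys. ys \<in> ?C \<and> set ys \<inter> set xs \<noteq> {}}"
      have Ov: "?Ov \<subseteq> ?C" by auto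
      have "(\<Sum>ys\<in>?C. p ^ card (cyc ys - cyc xs) / real (length ys)) =
          (\<Sum>ys\<in>?C - ?Ov. p ^ card (cyc ys - cyc xs) / real (length ys)) +
          (\<Sum>ys\<in>?Ov. p ^ card (cyc ys - cyc xs) / real (length ys))"
        by (rule sum.subset_diff[OF Ov]) simp
      also have "(\<Sum>ys\<in>?C - ?Ov. p ^ card (cyc ys - cyc xs) / real (length ys)) =
          (\<Sum>ys\<in>?C - ?Ov. p ^ length ys / real (length ys))"
      proof (rule sum.cong[OF refl])
        fix ys assume ys: "ys \<in> ?C - ?Ov"
        then have "cyc ys - cyc xs = cyc ys"
          using cyc_subset_Times[of ys] cyc_subset_Times[of xs] by blast
        then show "p ^ card (cyc ys - cyc xs) / real (length ys) = p ^ length ys / real (length ys)"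
          using slots(2)[of ys] ys by simp
      qed
      also have "\<dots> \<le> s"
        unfolding s_def using p by (intro sum_mono2) auto
      also have "(\<Sum>ys\<in>?Ov. p ^ card (cyc ys - cyc xs) / real (length ys)) \<le> 2"
        by (rule cycle_overlap_sum[where \<mu> = \<mu>]) (use a p \<mu> small xs in auto)
      finally show "(\<Sum>ys\<in>?C. p ^ card (cyc ys - cyc xs) / real (length ys)) \<le> s + 2"
        by simp
    qed (use p in simp)
    also have "\<dots> = s * (s + 2)"
      by (simp add: s_def sum_distrib_right)
    finally show ?thesis .
  qed
  have "s\<^sup>2 * arcs_prob n p (\<lambda>b. \<forall>xs\<in>?C. \<not> cyc xs \<subseteq> Collect b) =
      (\<integral>b. s\<^sup>2 * indicator {b. \<forall>xs\<in>?C. \<not> cyc xs \<subseteq> Collect b} b \<partial>?M)"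
    by simp
  \<comment> \<open>The right-hand integrand is \<open>(Z b - s)\<^sup>2\<close> expanded; where no
    cycle is present it equals \<open>s\<^sup>2\<close>.\<close>
  also have "\<dots> \<le> (\<integral>b. (Z b)\<^sup>2 + (s\<^sup>2 - 2 * s * Z b) \<partial>?M)"
  proof (rule integral_mono)
    fix b
    show "s\<^sup>2 * indicator {b. \<forall>xs\<in>?C. \<not> cyc xs \<subseteq> Collect b} b \<le> (Z b)\<^sup>2 + (s\<^sup>2 - 2 * s * Z b)"
    proof (cases "\<forall>xs\<in>?C. \<not> cyc xs \<subseteq> Collect b")
      case True
      then have "Z b = 0" by (simp add: Z_def I_def)
      then show ?thesis by (simp add: indicator_def)
    next
      case False
      have "0 \<le> (Z b - s)\<^sup>2" by simp
      then show ?thesis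
        using False by (simp add: power2_diff algebra_simps)
    qed
  qed simp_all
  also have "\<dots> = (\<integral>b. (Z b)\<^sup>2 \<partial>?M) - s\<^sup>2"
    by (simp add: EZ power2_eq_square)
  also have "\<dots> \<le> 2 * s"
    using EZ2 by (simp add: power2_eq_square algebra_simps)
  finally show ?thesis
    using s by (simp add: field_simps power2_eq_square)
qed

section \<open>Expected number of long cycles\<close>

lemma sum_inverse_ge_ln:
  assumes "1 \<le> a" "a \<le> m + 1"
  shows "ln (real (m + 1) / real a) \<le> (\<Sum>L=a..m. 1 / real L)"
  using assms(2)
proof (induction m)
  case 0
  then show ?case using assms(1) by simp
next
  case (Suc m)
  show ?case
  proof (cases "a \<le> m + 1")
    case True
    have "real (Suc m + 1) / real a = real (m + 1) / real a * (1 + 1 / real (m + 1))"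
    proof -
      have "x + 1 = x * (1 + 1 / x)" if "x > 0" for x :: real
        using that by (simp add: distrib_left)
      from this[of "real (m + 1)"] show ?thesis
        by (simp add: add.commute)
    qed
    then have "ln (real (Suc m + 1) / real a) = ln (real (m + 1) / real a) + ln (1 + 1 / real (m + 1))"
      using assms(1) by (simp only:) (intro ln_mult_pos divide_pos_pos add_pos_pos; simp)
    also have "\<dots> \<le> (\<Sum>L=a..m. 1 / real L) + 1 / real (m + 1)"
      using Suc.IH[OF True] ln_add_one_self_le_self[of "1 / real (m + 1)"] by simp
    also have "\<dots> = (\<Sum>L=a..Suc m. 1 / real L)"
      using True by simp
    finally show ?thesis .
  next
    case False
    then show ?thesis using Suc.prems by simp
  qed
qed

text \<open>The count is a falling factorial with \<open>L\<close> factors, each at least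
  \<open>n - L\<close>, and Bernoulli's inequality gives
  \<open>(1 - L / n) ^ L \<ge> 1 - L\<^sup>2 / n \<ge> 1 / 2\<close>.\<close>

lemma card_distinct_lists_ge:
  assumes "2 * L\<^sup>2 \<le> n"
  shows "real n ^ L / 2 \<le> real (card {xs. length xs = L \<and> distinct xs \<and> set xs \<subseteq> {1..n}})"
proof (cases "L = 0")
  case True
  have "{xs. xs = [] \<and> distinct xs \<and> set xs \<subseteq> {1..n}} = {[]}" by auto
  then show ?thesis using True by simp
next
  case False
  then have Ln: "L \<le> n" "0 < n"
    using assms self_le_power[of L 2] by auto
  have "real n ^ L / 2 \<le> real n ^ L * (1 - real L * (real L / real n))"
  proof -
    have "2 * (real L * real L) \<le> real n"
      using of_nat_mono[OF assms, where 'a = real] by (simp add: power2_eq_square)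
    then have "1 / 2 \<le> 1 - real L * (real L / real n)"
      using Ln by (simp add: field_simps)
    then have "real n ^ L * (1 / 2) \<le> real n ^ L * (1 - real L * (real L / real n))"
      by (rule mult_left_mono) simp
    then show ?thesis by simp
  qed
  also have "\<dots> \<le> real n ^ L * (1 + - (real L / real n)) ^ L"
    using Bernoulli_inequality[of "- (real L / real n)" L] Ln
    by (intro mult_left_mono) (auto simp: field_simps)
  also have "\<dots> = real (n - L) ^ L"
    using Ln by (simp add: power_mult_distrib[symmetric] algebra_simps of_nat_diff)
  also have "\<dots> \<le> real (\<Prod>{n - L + 1..n})"
  proof -
    have "(\<Prod>i\<in>{n - L + 1..n}. n - L) \<le> \<Prod>{n - L + 1..n}"
      by (intro prod_mono) auto
    moreover have "(\<Prod>i\<in>{n - L + 1..n}. n - L) = (n - L) ^ L"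
      using Ln by simp
    ultimately show ?thesis
      by (metis of_nat_mono of_nat_power)
  qed
  also have "\<dots> = real (card {xs. length xs = L \<and> distinct xs \<and> set xs \<subseteq> {1..n}})"
    using card_lists_distinct_length_eq[of "{1..n}" L] Ln by simp
  finally show ?thesis .
qed

text \<open>Each length \<open>L\<close> contributes at least \<open>1 / (4 * L)\<close>: one factor
  1/2 pays for distinct vertices, the other is the bound on \<open>(n * p) ^ L\<close>. The harmonic
  sum then yields the logarithm.\<close>

lemma expected_cycles_ge:
  assumes a: "1 \<le> a" "a \<le> m + 1" and p: "0 \<le> p" and m: "2 * m\<^sup>2 \<le> n"
    and np: "\<And>L. L \<in> {a..m} \<Longrightarrow> 1 / 2 \<le> (real n * p) ^ L"
  shows "ln (real (m + 1) / real a) / 4 \<le> (\<Sum>xs\<in>cycles n a m. p ^ length xs / real (length xs))"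
proof -
  have "ln (real (m + 1) / real a) / 4 \<le> (\<Sum>L=a..m. 1 / real L) / 4"
    using sum_inverse_ge_ln[OF a] by simp
  also have "\<dots> = (\<Sum>L\<in>{a..m}. 1 / 4 / real L)"
    by (simp add: sum_divide_distrib field_simps)
  also have "\<dots> \<le> (\<Sum>L\<in>{a..m}. \<Sum>xs | xs \<in> cycles n a m \<and> length xs = L. p ^ length xs / real (length xs))"
  proof (rule sum_mono)
    fix L assume L: "L \<in> {a..m}"
    have eq: "{xs. xs \<in> cycles n a m \<and> length xs = L} =
        {xs. length xs = L \<and> distinct xs \<and> set xs \<subseteq> {1..n}}"
      using L by (auto simp: cycles_def)
    have "2 * L\<^sup>2 \<le> n"
      using L by (intro order_trans[OF _ m] mult_le_mono2 power_mono) auto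
    then have card: "real n ^ L / 2 \<le> real (card {xs. xs \<in> cycles n a m \<and> length xs = L})"
      unfolding eq by (rule card_distinct_lists_ge)
    have "1 / 4 \<le> (real n * p) ^ L / 2"
      using np[OF L] by simp
    also have "\<dots> = real n ^ L / 2 * p ^ L"
      by (simp add: power_mult_distrib)
    also have "\<dots> \<le> real (card {xs. xs \<in> cycles n a m \<and> length xs = L}) * p ^ L"
      using p by (intro mult_right_mono card) auto
    finally have "1 / 4 / real L \<le> real (card {xs. xs \<in> cycles n a m \<and> length xs = L}) * p ^ L / real L"
      by (rule divide_right_mono) simp
    then show "1 / 4 / real L \<le> (\<Sum>xs | xs \<in> cycles n a m \<and> length xs = L. p ^ length xs / real (length xs))"
      by simp
  qed
  also have "\<dots> = (\<Sum>xs\<in>cycles n a m. p ^ length xs / real (length xs))"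
    by (rule sum.group[OF finite_cycles]) (auto simp: cycles_def)
  finally show ?thesis .
qed

section \<open>The critical window\<close>

text \<open>A cycle with between \<open>\<delta> * t\<close> and \<open>\<eta> * t\<close> vertices
  suffices. The relation \<open>\<eta> * (1 + \<bar>lam\<bar>) = 1 / 4\<close> keeps
  \<open>\<mu> ^ m\<close> at most 2 and intersecting pairs rare, while a small
  \<open>\<delta>\<close> makes the mean large. The factor 2 beside \<open>\<delta>\<close> absorbs
  the rounding in \<open>a\<close>; the constant 8 is 2 from \<open>no_cycle_prob\<close> times 4
  from \<open>expected_cycles_ge\<close>.\<close>

lemma largest_scc_size_lower_tail_critical:
  fixes lam t \<delta> :: real
  assumes n: "real n = t ^ 3" and t: "2 * (1 + \<bar>lam\<bar>) \<le> t"
  defines "p \<equiv> (1 + lam / t) / real n"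
  defines "\<eta> \<equiv> 1 / (4 * (1 + \<bar>lam\<bar>))"
  assumes \<delta>: "2 \<le> \<delta> * t" "2 * \<delta> < \<eta>"
  shows "measure_pmf.prob (random_digraph n p) {G. real (largest_scc_size G) < \<delta> * t}
      \<le> 8 / ln (\<eta> / (2 * \<delta>))"
proof -
  define m where "m = nat \<lfloor>\<eta> * t\<rfloor>"
  define a where "a = nat \<lceil>\<delta> * t\<rceil>"
  define \<mu> where "\<mu> = 1 + \<bar>lam\<bar> / t"
  define s where "s = (\<Sum>xs\<in>cycles n a m. p ^ length xs / real (length xs))"
  have t2: "2 \<le> t"
    using t abs_ge_zero[of lam] by (simp add: algebra_simps)
  have n0: "0 < real n"
    unfolding n using t2 by simp
  have \<delta>0: "0 < \<delta>"
    using \<delta>(1) t2 zero_less_mult_pos2[of \<delta> t] by linarith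
  have \<eta>: "0 < \<eta>" "\<eta> \<le> 1 / 4" "\<eta> * (1 + \<bar>lam\<bar>) = 1 / 4"
    by (simp_all add: \<eta>_def field_simps)
  have \<eta>lam: "\<bar>lam\<bar> * \<eta> \<le> 1 / 4"
    using \<eta> by (simp add: algebra_simps)
  have \<delta>\<eta>: "2 * (\<delta> * t) \<le> \<eta> * t"
    using mult_right_mono[of "2 * \<delta>" \<eta> t] \<delta>(2) t2 by simp
  have m: "real m \<le> \<eta> * t" "\<eta> * t \<le> real m + 1"
    unfolding m_def using \<eta>(1) t2 mult_pos_pos[of \<eta> t] by linarith+
  have a: "\<delta> * t \<le> real a" "real a \<le> 2 * (\<delta> * t)"
    unfolding a_def using \<delta>(1) by linarith+
  have a2: "2 \<le> a"
    using a(1) \<delta>(1) by linarith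
  have am: "a \<le> m + 1"
    using a(2) \<delta>\<eta> m(2) by linarith
  have np: "real n * p = 1 + lam / t"
    using n0 by (simp add: p_def)
  have lam: "\<bar>lam / t\<bar> \<le> 1 / 2"
    using t t2 by (simp add: field_simps)
  then have lam': "- (1 / 2) \<le> lam / t"
    using abs_le_D2[of "lam / t" "1 / 2"] by linarith
  have p0: "0 \<le> p"
    unfolding p_def using lam' n0 by (intro divide_nonneg_pos) auto
  have np\<mu>: "real n * p \<le> \<mu>"
    unfolding np \<mu>_def using t2 by (simp add: divide_right_mono)
  have \<mu>1: "1 \<le> \<mu>"
    using t2 by (simp add: \<mu>_def)
  have p_le: "p \<le> (1 + \<bar>lam\<bar>) / t ^ 3"
  proof -
    have "\<bar>lam\<bar> / t \<le> \<bar>lam\<bar> / 1"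
      using t2 by (intro divide_left_mono) auto
    then have "\<mu> \<le> 1 + \<bar>lam\<bar>"
      by (simp add: \<mu>_def)
    then have "real n * p \<le> 1 + \<bar>lam\<bar>"
      using np\<mu> by simp
    then show ?thesis
      using n0 by (simp add: n[symmetric] field_simps)
  qed
  have t3: "t \<le> t ^ 3"
    using t2 power_increasing[of 1 3 t] by simp
  have p1: "p \<le> 1"
  proof -
    have "1 + \<bar>lam\<bar> \<le> t ^ 3"
      using t t3 abs_ge_zero[of lam] by (simp add: algebra_simps)
    then have "(1 + \<bar>lam\<bar>) / t ^ 3 \<le> 1"
      using t2 by simp
    then show ?thesis using p_le by linarith
  qed
  have \<mu>m: "\<mu> ^ m \<le> 2"
  proof -
    have "\<mu> ^ m \<le> exp (\<bar>lam\<bar> / t) ^ m"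
      using exp_ge_add_one_self[of "\<bar>lam\<bar> / t"] \<mu>1 by (intro power_mono) (auto simp: \<mu>_def)
    also have "\<dots> = exp (\<bar>lam\<bar> * (real m / t))"
      by (simp add: exp_of_nat_mult[symmetric] mult.commute)
    also have "\<dots> \<le> exp (1 / 2)"
    proof -
      have "real m / t \<le> \<eta>"
        using m(1) t2 by (simp add: field_simps)
      then have "\<bar>lam\<bar> * (real m / t) \<le> \<bar>lam\<bar> * \<eta>"
        by (rule mult_left_mono) simp
      then show ?thesis
        using \<eta>lam by simp
    qed
    also have "\<dots> \<le> 2"
      using exp_half_le2 by simp
    finally show ?thesis .
  qed
  have \<eta>t: "1 \<le> \<eta> * t"
    using \<delta>\<eta> \<delta>(1) by linarith
  \<comment> \<open>Since \<open>1 \<le> \<eta> * t\<close>, the last factor is at most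
    \<open>5 * (\<eta> * t)\<close>; the three powers of \<open>t\<close> then cancel against
    \<open>n = t ^ 3\<close>.\<close>
  have small: "p * real m * real m * (1 + 2 * \<mu> ^ m * real m) \<le> 1"
  proof -
    have "1 + 2 * \<mu> ^ m * real m \<le> 1 + 2 * 2 * (\<eta> * t)"
      using \<mu>m m(1) \<mu>1 by (intro add_left_mono mult_mono) auto
    also have "\<dots> \<le> 5 * (\<eta> * t)"
      using \<eta>t by simp
    finally have "p * real m * real m * (1 + 2 * \<mu> ^ m * real m) \<le>
        (1 + \<bar>lam\<bar>) / t ^ 3 * (\<eta> * t) * (\<eta> * t) * (5 * (\<eta> * t))"
      using p_le m(1) p0 \<mu>1 \<eta> t2 by (intro mult_mono) auto
    also have "\<dots> = 5 * (\<eta> * (1 + \<bar>lam\<bar>)) * (\<eta> * \<eta>)"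
      using t2 by (simp add: power3_eq_cube field_simps)
    also have "\<dots> \<le> 5 * (1 / 4) * (1 / 4 * (1 / 4))"
      unfolding \<eta>(3) using \<eta> by (intro mult_left_mono mult_mono) auto
    finally show ?thesis by simp
  qed
  have m2: "2 * m\<^sup>2 \<le> n"
  proof -
    have "(real m)\<^sup>2 \<le> (1 / 4 * t)\<^sup>2"
    proof (rule power_mono)
      have "\<eta> * t \<le> 1 / 4 * t"
        using \<eta>(2) t2 by (intro mult_right_mono) auto
      then show "real m \<le> 1 / 4 * t"
        using m(1) by linarith
    qed simp
    also have "\<dots> \<le> t ^ 3 / 2"
      using t2 by (simp add: power2_eq_square power3_eq_cube field_simps)
    finally have "real (2 * m\<^sup>2) \<le> real n"
      by (simp add: n)
    then show ?thesis
      by (simp only: of_nat_le_iff)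
  qed
  \<comment> \<open>For negative \<open>lam\<close> the powers decay, but
    \<open>L \<le> \<eta> * t\<close> limits the loss by Bernoulli's inequality.\<close>
  have half: "1 / 2 \<le> (real n * p) ^ L" if L: "L \<in> {a..m}" for L
  proof -
    have "\<bar>real L * (lam / t)\<bar> = \<bar>lam\<bar> * (real L / t)"
      using t2 by (simp add: abs_mult)
    also have "\<dots> \<le> \<bar>lam\<bar> * \<eta>"
      using L m(1) t2 by (intro mult_left_mono) (auto simp: field_simps)
    also have "\<dots> \<le> 1 / 4"
      by (rule \<eta>lam)
    finally have "1 / 2 \<le> 1 + real L * (lam / t)"
      by linarith
    also have "\<dots> \<le> (1 + lam / t) ^ L"
      using lam' by (intro Bernoulli_inequality) linarith
    finally show ?thesis by (simp add: np)
  qed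
  have ln_pos: "0 < ln (\<eta> / (2 * \<delta>))"
    using \<delta>0 \<delta>(2) by simp
  have s_ge: "ln (\<eta> / (2 * \<delta>)) / 4 \<le> s"
  proof -
    have "\<eta> / (2 * \<delta>) = (\<eta> * t) / (2 * (\<delta> * t))"
      using t2 by simp
    also have "\<dots> \<le> real (m + 1) / real a"
      using m(2) a a2 by (intro frac_le) auto
    finally have "ln (\<eta> / (2 * \<delta>)) \<le> ln (real (m + 1) / real a)"
      using \<delta>0 \<eta>(1) by (intro ln_mono) auto
    moreover have "ln (real (m + 1) / real a) / 4 \<le> s"
      unfolding s_def by (rule expected_cycles_ge) (use a2 am p0 m2 half in auto)
    ultimately show ?thesis by linarith
  qed
  have "measure_pmf.prob (random_digraph n p) {G. real (largest_scc_size G) < \<delta> * t}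
      = arcs_prob n p (\<lambda>b. real (largest_scc_size \<lparr>pverts = {1..n}, parcs = Collect b\<rparr>) < \<delta> * t)"
    by (simp add: random_digraph_eq vimage_def)
  also have "\<dots> \<le> arcs_prob n p (\<lambda>b. \<forall>xs\<in>cycles n a m. \<not> cyc xs \<subseteq> Collect b)"
  proof (rule arcs_prob_mono, rule ballI, rule notI)
    fix b xs
    assume b: "b \<in> set_pmf (arcs_pmf n p)" and xs: "xs \<in> cycles n a m" "cyc xs \<subseteq> Collect b"
      and less: "real (largest_scc_size \<lparr>pverts = {1..n}, parcs = Collect b\<rparr>) < \<delta> * t"
    have "length xs \<le> largest_scc_size \<lparr>pverts = {1..n}, parcs = Collect b\<rparr>"
      using xs a2 by (intro largest_scc_size_ge_cycle pair_digraph_arcs_pmf[OF b]) (auto simp: cycles_def)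
    moreover have "a \<le> length xs"
      using xs by (simp add: cycles_def)
    ultimately show False
      using less a(1) by linarith
  qed
  also have "\<dots> \<le> 2 / s"
    unfolding s_def
  proof (rule no_cycle_prob[OF a2 p0 p1 \<mu>1 np\<mu> small])
    show "0 < (\<Sum>xs\<in>cycles n a m. p ^ length xs / real (length xs))"
      using s_ge ln_pos unfolding s_def by linarith
  qed
  also have "\<dots> \<le> 2 / (ln (\<eta> / (2 * \<delta>)) / 4)"
    using s_ge ln_pos by (intro divide_left_mono mult_pos_pos) auto
  finally show ?thesis by simp
qed

theorem corollary1p6:
  fixes lam :: real
  shows "Theta_p
           (\<lambda>n. measure_pmf (random_digraph n (1 / real n + lam * real n powr (- 4 / 3))))
           (\<lambda>n G. real (largest_scc_size G))
           (\<lambda>n. real n powr (1 / 3))"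
  unfolding Theta_p_def
proof (intro allI impI)
  fix \<epsilon> :: real assume \<epsilon>: "0 < \<epsilon>"
  define K where "K = 18 * exp (2 * (\<bar>lam\<bar> + 2 * (1 + \<bar>lam\<bar>)\<^sup>2))"
  define \<eta> where "\<eta> = 1 / (4 * (1 + \<bar>lam\<bar>))"
  \<comment> \<open>This makes \<open>ln (\<eta> / (2 * c))\<close> equal to
    \<open>16 / \<epsilon>\<close>, so the lower tail bound becomes
    \<open>\<epsilon> / 2\<close>.\<close>
  define c where "c = \<eta> / (2 * exp (16 / \<epsilon>))"
  \<comment> \<open>This makes \<open>K / C\<close> at most \<open>\<epsilon> / 2\<close>; the added
    1 ensures \<open>c < C\<close>.\<close>
  define C where "C = 2 * K / \<epsilon> + 1"
  \<comment> \<open>For \<open>t \<ge> T\<close> both tail bounds apply: \<open>t\<close> is large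
    against \<open>lam\<close>, and \<open>c * t \<ge> 2\<close>.\<close>
  define T where "T = max (2 * (1 + \<bar>lam\<bar>)) (2 / c)"
  define n0 where "n0 = nat \<lceil>T ^ 3\<rceil>"
  have \<eta>: "0 < \<eta>" "\<eta> \<le> 1"
    by (simp_all add: \<eta>_def field_simps)
  have c: "0 < c" "2 * c < \<eta>" "c < 1"
  proof -
    have e: "1 < exp (16 / \<epsilon>)"
      using \<epsilon> by simp
    show "0 < c"
      using \<eta> by (simp add: c_def)
    have "\<eta> / exp (16 / \<epsilon>) < \<eta> / 1"
      using \<eta> e by (intro divide_strict_left_mono) auto
    then show "2 * c < \<eta>"
      by (simp add: c_def)
    then show "c < 1"
      using \<eta> \<open>0 < c\<close> by linarith
  qed
  have K: "0 < K"
    by (simp add: K_def)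
  have C: "1 < C" "K / C \<le> \<epsilon> / 2"
    using K \<epsilon> by (simp_all add: C_def field_simps)
  have T: "2 \<le> T"
    unfolding T_def using abs_ge_zero[of lam] by (intro max.coboundedI1) simp
  have "1 - \<epsilon> \<le> \<P>(G in measure_pmf (random_digraph n (1 / real n + lam * real n powr (- 4 / 3))).
      c * real n powr (1 / 3) \<le> real (largest_scc_size G) \<and>
      real (largest_scc_size G) \<le> C * real n powr (1 / 3))" if "n0 \<le> n" for n
  proof -
    define t where "t = real n powr (1 / 3)"
    define p where "p = (1 + lam / t) / real n"
    have nT: "T ^ 3 \<le> real n"
      using that unfolding n0_def by linarith
    then have n1: "0 < real n"
      using T zero_less_power[of T 3] by linarith
    have t3: "t ^ 3 = real n"
      using n1 by (simp add: t_def powr_power)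
    have tT: "T \<le> t"
      using nT T unfolding t3[symmetric] by (intro power_le_imp_le_base[of T 2 t]) (auto simp: numeral_3_eq_3 t_def)
    \<comment> \<open>Here \<open>n * t = n powr (4 / 3)\<close>, which puts the edge probability
      into the form of the tail bounds.\<close>
    have p_eq: "1 / real n + lam * real n powr (- 4 / 3) = p"
    proof -
      have "real n powr (- 4 / 3) = 1 / (real n powr 1 * real n powr (1 / 3))"
        unfolding powr_add[symmetric] by (simp add: powr_minus_divide)
      then show ?thesis
        using n1 by (simp add: p_def t_def field_simps)
    qed
    have t: "2 * (1 + \<bar>lam\<bar>) \<le> t" "2 \<le> c * t" "1 \<le> C * t"
    proof -
      show "2 * (1 + \<bar>lam\<bar>) \<le> t"
        using tT by (simp add: T_def)
      have "2 / c \<le> t"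
        using tT by (simp add: T_def)
      then show "2 \<le> c * t"
        using c by (simp add: field_simps)
      show "1 \<le> C * t"
        using C T tT mult_mono[of 1 C 1 t] by simp
    qed
    let ?P = "measure_pmf.prob (random_digraph n p)"
    have low: "?P {G. real (largest_scc_size G) < c * t} \<le> \<epsilon> / 2"
    proof -
      have "?P {G. real (largest_scc_size G) < c * t} \<le> 8 / ln (\<eta> / (2 * c))"
        unfolding p_def \<eta>_def
        by (rule largest_scc_size_lower_tail_critical) (use t3 t c in \<open>auto simp: \<eta>_def\<close>)
      also have "\<eta> / (2 * c) = exp (16 / \<epsilon>)"
        using \<eta> by (simp add: c_def)
      finally show ?thesis
        using \<epsilon> by simp
    qed
    have up: "?P {G. C * t < real (largest_scc_size G)} \<le> \<epsilon> / 2"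
    proof -
      have "?P {G. C * t < real (largest_scc_size G)} \<le> real n * (K / t\<^sup>2) / (C * t)"
      proof (rule largest_scc_size_upper_tail)
        show "arcs_prob n p (\<lambda>b. (v, v) \<in> (Collect b)\<^sup>+) \<le> K / t\<^sup>2" if "v \<in> {1..n}" for v
          unfolding p_def K_def using t3 t that by (intro closed_walk_prob_critical) auto
      qed (use t n1 in auto)
      also have "\<dots> = K / C"
        using T tT by (simp add: t3[symmetric] power3_eq_cube power2_eq_square)
      finally show ?thesis
        using C by linarith
    qed
    have "1 - ?P {G. c * t \<le> real (largest_scc_size G) \<and> real (largest_scc_size G) \<le> C * t} =
        ?P {G. \<not> (c * t \<le> real (largest_scc_size G) \<and> real (largest_scc_size G) \<le> C * t)}"
      using measure_pmf.prob_neg[where M = "random_digraph n p" and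
        P = "\<lambda>G. c * t \<le> real (largest_scc_size G) \<and> real (largest_scc_size G) \<le> C * t"] by simp
    also have "{G. \<not> (c * t \<le> real (largest_scc_size G) \<and> real (largest_scc_size G) \<le> C * t)} =
        {G. real (largest_scc_size G) < c * t} \<union> {G. C * t < real (largest_scc_size G)}"
      by auto
    also have "?P \<dots> \<le> ?P {G. real (largest_scc_size G) < c * t} + ?P {G. C * t < real (largest_scc_size G)}"
      by (rule measure_Un_le) auto
    finally have "1 - \<epsilon> \<le> ?P {G. c * t \<le> real (largest_scc_size G) \<and> real (largest_scc_size G) \<le> C * t}"
      using low up by linarith
    then show ?thesis
      unfolding p_eq by (simp add: t_def)
  qed
  then show "\<exists>c C n0. 0 < c \<and> c < C \<and> (\<forall>n\<ge>n0. 1 - \<epsilon> \<le>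
      \<P>(G in measure_pmf (random_digraph n (1 / real n + lam * real n powr (- 4 / 3))).
        c * real n powr (1 / 3) \<le> real (largest_scc_size G) \<and>
        real (largest_scc_size G) \<le> C * real n powr (1 / 3)))"
    using c C by (intro exI[of _ c] exI[of _ C] exI[of _ n0]) auto
qed

end
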